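(* For every triple $(r,s,t)$ of positive integers, let $\mathcal{Q}(r,s,t)$ be the set of orders of the finite quotients of the ordinary triangle group $\Delta^+(r,s,t)$. Then the natural density of $\mathcal{Q}(r,s,t)$ exists and equals zero, i.e. $$\lim_{x\to\infty}\frac{|\mathcal{Q}(r,s,t)\cap\{1,\dots,x\}|}{x}=0.$$
   Context: For positive integers $r,s,t$, the ordinary triangle group is the group with presentation $\Delta^+(r,s,t)=\langle\, x,y,z \mid x^r=y^s=z^t=xyz=1\,\rangle$, equivalently $\langle\, x,y\mid x^r=y^s=(xy)^t=1\,\rangle$. A finite quotient of a group is any finite group that is a homomorphic image of it (the orders of the generators need not be preserved). For a set $S$ of positive integers, put $d_x(S)=|S\cap\{1,\dots,x\}|/x$; the natural density of $S$ is $d(S)=\lim_{x\to\infty}d_x(S)$ when this limit exists. *)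

theory Defs
  imports Complex_Main "HOL-Algebra.Coset"
begin

section \<open>Groups given by generators and relators\<close>

text \<open>A letter \<open>(a, True)\<close> stands for the generator \<open>a\<close> and \<open>(a, False)\<close> for its formal inverse.
  The generating set is the whole type \<open>'a\<close>.\<close>

type_synonym 'a gword = "('a \<times> bool) list"

text \<open>The least congruence on the free monoid of words that makes \<open>a\<close> and its formal inverse
  cancel and every word in \<open>R\<close> trivial.\<close>

inductive word_eq :: "'a gword set \<Rightarrow> 'a gword \<Rightarrow> 'a gword \<Rightarrow> bool" for R where
  refl: "word_eq R w w"
| sym: "word_eq R v w \<Longrightarrow> word_eq R w v"
| trans: "word_eq R u v \<Longrightarrow> word_eq R v w \<Longrightarrow> word_eq R u w"
| cancel: "word_eq R (u @ (a, b) # (a, \<not> b) # v) (u @ v)"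
| relator: "q \<in> R \<Longrightarrow> word_eq R (u @ q @ v) (u @ v)"

definition word_class :: "'a gword set \<Rightarrow> 'a gword \<Rightarrow> 'a gword set" where
  "word_class R w = {v. word_eq R w v}"

definition presented_group :: "'a gword set \<Rightarrow> 'a gword set monoid" where
  "presented_group R =
    \<lparr>carrier = range (word_class R),
     mult = (\<lambda>A B. \<Union>u\<in>A. \<Union>v\<in>B. word_class R (u @ v)),
     one = word_class R []\<rparr>"

lemma word_class_eq_iff: "word_class R v = word_class R w \<longleftrightarrow> word_eq R v w"
proof
  assume "word_class R v = word_class R w"
  moreover have "w \<in> word_class R w"
    unfolding word_class_def mem_Collect_eq by (rule word_eq.refl)
  ultimately have "w \<in> word_class R v" by simp
  then show "word_eq R v w" unfolding word_class_def mem_Collect_eq .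
next
  assume vw: "word_eq R v w"
  have "word_eq R v u \<longleftrightarrow> word_eq R w u" for u
    using word_eq.trans[OF vw, of u] word_eq.trans[OF word_eq.sym[OF vw], of u] by (rule iffI[rotated])
  then show "word_class R v = word_class R w"
    by (simp add: word_class_def)
qed

lemma word_eq_context: "word_eq R v w \<Longrightarrow> word_eq R (p @ v @ s) (p @ w @ s)"
proof (induction rule: word_eq.induct)
  case (cancel u a b v)
  show ?case using word_eq.cancel[of R "p @ u" a b "v @ s"] by simp
next
  case (relator q u v)
  then show ?case using word_eq.relator[of q R "p @ u" "v @ s"] by simp
next
  case (refl w)
  show ?case by (rule word_eq.refl)
next
  case (sym v w)
  show ?case by (rule word_eq.sym[OF sym.IH])
next
  case (trans u v w)
  show ?case by (rule word_eq.trans[OF trans.IH])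
qed

lemma word_eq_append: "word_eq R u u' \<Longrightarrow> word_eq R v v' \<Longrightarrow> word_eq R (u @ v) (u' @ v')"
  using word_eq_context[of R u u' "[]" v] word_eq_context[of R v v' u' "[]"]
    word_eq.trans[of R "u @ v" "u' @ v" "u' @ v'"]
  by simp

lemma presented_group_mult:
  "word_class R u \<otimes>\<^bsub>presented_group R\<^esub> word_class R v = word_class R (u @ v)"
proof -
  have "word_class R (u' @ v') = word_class R (u @ v)"
    if "u' \<in> word_class R u" "v' \<in> word_class R v" for u' v'
  proof -
    have "word_eq R (u @ v) (u' @ v')"
      using that by (simp add: word_class_def word_eq_append)
    then show ?thesis unfolding word_class_eq_iff by (rule word_eq.sym)
  qed
  moreover have "u \<in> word_class R u" "v \<in> word_class R v"
    by (auto simp: word_class_def intro: word_eq.refl)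
  ultimately have "(\<Union>u'\<in>word_class R u. \<Union>v'\<in>word_class R v. word_class R (u' @ v'))
      = word_class R (u @ v)"
    by blast
  then show ?thesis by (simp add: presented_group_def)
qed

definition inv_word :: "'a gword \<Rightarrow> 'a gword" where
  "inv_word w = rev (map (\<lambda>(a, b). (a, \<not> b)) w)"

lemma inv_word_cancel: "word_eq R (inv_word w @ w) []"
proof (induction w)
  case Nil
  show ?case by (simp add: inv_word_def word_eq.refl)
next
  case (Cons l w)
  obtain a b where l: "l = (a, b)" by fastforce
  have "word_eq R (inv_word (l # w) @ (l # w)) (inv_word w @ w)"
    using word_eq.cancel[of R "inv_word w" a "\<not> b" w] by (simp add: inv_word_def l)
  then show ?case using Cons.IH by (rule word_eq.trans)
qed

lemma group_presented_group: "group (presented_group R)"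
proof (rule groupI)
  let ?G = "presented_group R"
  have car: "carrier ?G = range (word_class R)" and one: "\<one>\<^bsub>?G\<^esub> = word_class R []"
    by (simp_all add: presented_group_def)
  show "\<one>\<^bsub>?G\<^esub> \<in> carrier ?G" by (simp add: car one)
  show "x \<otimes>\<^bsub>?G\<^esub> y \<in> carrier ?G" if "x \<in> carrier ?G" "y \<in> carrier ?G" for x y
    using that by (auto simp: car presented_group_mult)
  show "x \<otimes>\<^bsub>?G\<^esub> y \<otimes>\<^bsub>?G\<^esub> z = x \<otimes>\<^bsub>?G\<^esub> (y \<otimes>\<^bsub>?G\<^esub> z)"
    if "x \<in> carrier ?G" "y \<in> carrier ?G" "z \<in> carrier ?G" for x y z
    using that by (auto simp: car presented_group_mult)
  show "\<one>\<^bsub>?G\<^esub> \<otimes>\<^bsub>?G\<^esub> x = x" if "x \<in> carrier ?G" for x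
    using that by (auto simp: car one presented_group_mult)
  show "\<exists>y\<in>carrier ?G. y \<otimes>\<^bsub>?G\<^esub> x = \<one>\<^bsub>?G\<^esub>" if x: "x \<in> carrier ?G" for x
  proof -
    obtain w where "x = word_class R w" using x by (auto simp: car)
    then have "word_class R (inv_word w) \<otimes>\<^bsub>?G\<^esub> x = \<one>\<^bsub>?G\<^esub>"
      by (simp add: one presented_group_mult word_class_eq_iff inv_word_cancel)
    then show ?thesis by (auto simp: car)
  qed
qed

fun word_eval :: "('b, 'c) monoid_scheme \<Rightarrow> ('a \<Rightarrow> 'b) \<Rightarrow> 'a gword \<Rightarrow> 'b" where
  "word_eval H f [] = \<one>\<^bsub>H\<^esub>"
| "word_eval H f ((a, b) # w) = (if b then f a else inv\<^bsub>H\<^esub> (f a)) \<otimes>\<^bsub>H\<^esub> word_eval H f w"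

text \<open>The universal property.\<close>

lemma presented_group_universal:
  assumes "group H" and f: "\<And>a. f a \<in> carrier H"
    and R: "\<And>q. q \<in> R \<Longrightarrow> word_eval H f q = \<one>\<^bsub>H\<^esub>"
  obtains g where "g \<in> hom (presented_group R) H"
    and "\<And>w. g (word_class R w) = word_eval H f w"
proof -
  interpret H: group H by fact
  have ev: "word_eval H f w \<in> carrier H" for w
    by (induction w) (auto simp: f)
  have app: "word_eval H f (v @ w) = word_eval H f v \<otimes>\<^bsub>H\<^esub> word_eval H f w" for v w
    by (induction v) (auto simp: f ev H.m_assoc)
  have canc: "word_eval H f ((a, b) # (a, \<not> b) # v) = word_eval H f v" for a b v
    using H.m_assoc[of "f a" "inv\<^bsub>H\<^esub> f a" "word_eval H f v", symmetric]
      H.m_assoc[of "inv\<^bsub>H\<^esub> f a" "f a" "word_eval H f v", symmetric]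
    by (simp add: f ev)
  have inv: "word_eval H f v = word_eval H f w" if "word_eq R v w" for v w
    using that
  proof (induction rule: word_eq.induct)
    case (cancel u a b v)
    show ?case by (simp only: app canc)
  next
    case (relator q u v)
    then show ?case by (simp add: app R ev)
  qed simp_all
  define g where "g A = word_eval H f (SOME w. A = word_class R w)" for A
  have g: "g (word_class R w) = word_eval H f w" for w
  proof -
    have "word_class R w = word_class R (SOME v. word_class R w = word_class R v)"
      using someI[of "\<lambda>v. word_class R w = word_class R v" w] by blast
    then show ?thesis unfolding g_def word_class_eq_iff by (rule inv[symmetric])
  qed
  have "g \<in> hom (presented_group R) H"
  proof (rule homI)
    fix x assume "x \<in> carrier (presented_group R)"
    then show "g x \<in> carrier H" by (auto simp: presented_group_def g ev)
  next
    fix x y assume "x \<in> carrier (presented_group R)" "y \<in> carrier (presented_group R)"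
    then obtain v w where "x = word_class R v" "y = word_class R w"
      by (auto simp: presented_group_def)
    then show "g (x \<otimes>\<^bsub>presented_group R\<^esub> y) = g x \<otimes>\<^bsub>H\<^esub> g y"
      by (simp add: presented_group_mult g app)
  qed
  with g show thesis using that by blast
qed


section \<open>Ordinary triangle groups\<close>

datatype triangle_gen = Gen_x | Gen_y | Gen_z

definition triangle_relators :: "nat \<Rightarrow> nat \<Rightarrow> nat \<Rightarrow> triangle_gen gword set" where
  "triangle_relators r s t =
    {replicate r (Gen_x, True), replicate s (Gen_y, True), replicate t (Gen_z, True),
     [(Gen_x, True), (Gen_y, True), (Gen_z, True)]}"

definition triangle_group :: "nat \<Rightarrow> nat \<Rightarrow> nat \<Rightarrow> triangle_gen gword set monoid" where
  "triangle_group r s t = presented_group (triangle_relators r s t)"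


section \<open>Orders of finite quotients\<close>

text \<open>Every finite group is isomorphic to one whose elements are natural numbers, so restricting
  the underlying type of the quotient loses nothing; see \<open>finite_quotient_ordersI\<close>.\<close>

definition finite_quotient_orders :: "('a, 'b) monoid_scheme \<Rightarrow> nat set" where
  "finite_quotient_orders G =
    {order H | H :: nat monoid. group H \<and> finite (carrier H) \<and> epi G H \<noteq> {}}"

lemma finite_quotient_ordersI:
  fixes H :: "('c, 'd) monoid_scheme"
  assumes "group H" and fin: "finite (carrier H)" and h: "h \<in> epi G H"
  shows "order H \<in> finite_quotient_orders G"
proof -
  interpret H: group H by fact
  obtain e :: "'c \<Rightarrow> nat" where e: "inj_on e (carrier H)"
    using finite_imp_inj_to_nat_seg[OF fin] by blast
  define d where "d = inv_into (carrier H) e"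
  have d: "d (e x) = x" if "x \<in> carrier H" for x
    unfolding d_def by (rule inv_into_f_f[OF e that])
  define K :: "nat monoid" where
    "K = \<lparr>carrier = e ` carrier H, mult = (\<lambda>x y. e (d x \<otimes>\<^bsub>H\<^esub> d y)), one = e \<one>\<^bsub>H\<^esub>\<rparr>"
  have "group K"
  proof (rule groupI)
    fix x assume "x \<in> carrier K"
    then obtain u where "u \<in> carrier H" "x = e u" by (auto simp: K_def)
    then show "\<exists>y\<in>carrier K. y \<otimes>\<^bsub>K\<^esub> x = \<one>\<^bsub>K\<^esub>"
      by (intro bexI[of _ "e (inv\<^bsub>H\<^esub> u)"]) (auto simp: K_def d)
  qed (auto simp: K_def d H.m_assoc)
  moreover have "e \<circ> h \<in> epi G K"
  proof -
    have "(e \<circ> h) ` carrier G = carrier K"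
      using h unfolding image_comp[symmetric] by (simp add: epi_def K_def)
    moreover have "e \<circ> h \<in> hom G K"
      using h by (auto simp: epi_def hom_def K_def d Pi_iff)
    ultimately show ?thesis by (simp add: epi_def)
  qed
  moreover have "finite (carrier K)" "order K = order H"
    using fin e by (simp_all add: K_def order_def card_image)
  ultimately show ?thesis
    unfolding finite_quotient_orders_def mem_Collect_eq
    by (intro exI[of _ K]) auto
qed


section \<open>Natural density\<close>

definition partial_density :: "nat set \<Rightarrow> nat \<Rightarrow> real" where
  "partial_density S x = real (card (S \<inter> {1..x})) / real x"

definition has_natural_density :: "nat set \<Rightarrow> real \<Rightarrow> bool" where
  "has_natural_density S \<delta> \<longleftrightarrow> partial_density S \<longlonglongrightarrow> \<delta>"

end

theory Submission
  imports "HOL-Real_Asymp.Real_Asymp" Defs "HOL-Algebra.Sylow" "HOL-Algebra.Multiplicative_Group"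
    "HOL-Number_Theory.Number_Theory"
begin

text \<open>Let \<open>G\<close> be a quotient of order \<open>n\<close>, put \<open>N = r * s * t\<close>, and let \<open>p\<close> be a large prime dividing \<open>n\<close>
  exactly once such that no divisor \<open>d > 1\<close> of \<open>n\<close> is congruent to 1 modulo \<open>p\<close>. Then the Sylow
  \<open>p\<close>-subgroup \<open>Q\<close> of \<open>G\<close> is normal, and transfer yields an affine action of \<open>G\<close> on the integers modulo
  \<open>p\<close> in which \<open>Q\<close> acts by nontrivial translations. If \<open>gcd N (p - 1)\<close> divides 2, the generators
  \<open>x\<close>, \<open>y\<close> and \<open>x * y\<close> act with linear parts 1 or -1, and with linear part 1 only trivially; as at
  least one of the three has linear part 1, \<open>x\<close> and \<open>y\<close> share a fixed point, so \<open>G\<close> has a fixed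
  point, a contradiction.

  It remains to see that almost all \<open>n\<close> have such a prime divisor. The condition on the gcd holds if
  \<open>p\<close> is 3 modulo 4 and a quadratic nonresidue modulo every odd prime divisor of \<open>N\<close>. Mertens'
  method for real characters shows that these primes have positive logarithmic density, hence
  the sum of their reciprocals over the interval from \<open>u\<close> to \<open>u ^ D\<close> exceeds any given bound for a
  suitable \<open>D\<close> and all large \<open>u\<close>, and a second moment argument applies. For \<open>p > u\<close> the two conditions on
  \<open>n\<close> fail only on a set of density \<open>O(ln x / u)\<close>, which is negligible as \<open>u\<close> is a power of \<open>x\<close>.\<close>

section \<open>Chebyshev and Mertens estimates\<close>

lemma le_of_mult_le: "0 < k \<Longrightarrow> b * k \<le> x \<Longrightarrow> b \<le> (x::nat)"
  by (metis One_nat_def Suc_leI le_trans mult.right_neutral mult_le_mono2)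

text \<open>Both sides run over the pairs \<open>(d, m)\<close> with \<open>d * m \<le> x\<close>;
  on the left they are grouped by the product \<open>n = d * m\<close>.\<close>

lemma sum_divisors_swap:
  fixes F :: "nat \<Rightarrow> nat \<Rightarrow> 'a::comm_monoid_add"
  shows "(\<Sum>n=1..x. \<Sum>d | d dvd n. F d (n div d)) = (\<Sum>d=1..x. \<Sum>m=1..x div d. F d m)"
proof -
  have fin: "finite {d. d dvd n}" if "n \<in> {1..x}" for n
    using that by (intro finite_divisors_nat) auto
  have "(\<Sum>n=1..x. \<Sum>d | d dvd n. F d (n div d))
      = (\<Sum>(n,d)\<in>Sigma {1..x} (\<lambda>n. {d. d dvd n}). F d (n div d))"
    using fin by (intro sum.Sigma) auto
  also have "\<dots> = (\<Sum>(d,m)\<in>Sigma {1..x} (\<lambda>d. {1..x div d}). F d m)"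
    by (rule sum.reindex_bij_witness[where j = "\<lambda>(n,d). (d, n div d)" and i = "\<lambda>(d,m). (d*m, d)"])
       (auto simp: Suc_le_eq dvd_imp_le div_le_mono less_eq_div_iff_mult_less_eq mult.commute
          dest: dvd_imp_le elim!: dvdE intro!: Nat.gr0I dest: le_of_mult_le)
  also have "\<dots> = (\<Sum>d=1..x. \<Sum>m=1..x div d. F d m)"
    by (intro sum.Sigma[symmetric]) auto
  finally show ?thesis .
qed

text \<open>Summation by parts: the bounded partial sums of \<open>c\<close> get as weights the
  decrements of \<open>g\<close> and its last value, all nonnegative and of total
  \<open>g a\<close>.\<close>

lemma abs_sum_mult_antimono_le:
  fixes c g :: "nat \<Rightarrow> real"
  assumes C: "\<And>k. a \<le> k \<Longrightarrow> k \<le> b \<Longrightarrow> \<bar>\<Sum>n=a..<k. c n\<bar> \<le> B"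
    and anti: "\<And>n. a \<le> n \<Longrightarrow> g (Suc n) \<le> g n" and nonneg: "\<And>n. a \<le> n \<Longrightarrow> 0 \<le> g n"
    and "a \<le> b"
  shows "\<bar>\<Sum>n=a..<b. c n * g n\<bar> \<le> B * g a"
proof -
  define C where "C k = (\<Sum>n=a..<k. c n)" for k
  have "(\<Sum>n=a..<b. c n * g n) = (\<Sum>n=a..<b. C (Suc n) * (g n - g (Suc n))) + C b * g b"
    using \<open>a \<le> b\<close> by (induction b rule: dec_induct) (auto simp: C_def algebra_simps)
  moreover have "\<bar>\<Sum>n=a..<b. C (Suc n) * (g n - g (Suc n))\<bar> \<le> (\<Sum>n=a..<b. B * (g n - g (Suc n)))"
  proof (intro order.trans[OF sum_abs] sum_mono)
    fix n assume "n \<in> {a..<b}"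
    then show "\<bar>C (Suc n) * (g n - g (Suc n))\<bar> \<le> B * (g n - g (Suc n))"
      using C[of "Suc n"] anti[of n] unfolding abs_mult C_def by (intro mult_mono) auto
  qed
  moreover have "(\<Sum>n=a..<b. B * (g n - g (Suc n))) = B * (g a - g b)"
    using \<open>a \<le> b\<close> by (induction b rule: dec_induct) (auto simp: algebra_simps)
  moreover have "\<bar>C b * g b\<bar> \<le> B * g b"
    unfolding abs_mult using C[of b] nonneg[of b] \<open>a \<le> b\<close> by (auto simp: C_def intro!: mult_right_mono)
  ultimately show ?thesis by (simp add: algebra_simps)
qed

text \<open>Summing the identity that expresses \<open>ln n\<close> by \<open>mangoldt\<close> over
  the divisors of \<open>n\<close> counts each \<open>d\<close> once per multiple up to
  \<open>x\<close>.\<close>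

lemma sum_mangoldt_floor: "(\<Sum>d=1..x. mangoldt d * real (x div d)) = ln (fact x)"
proof -
  have "(\<Sum>d=1..x. mangoldt d * real (x div d)) = (\<Sum>d=1..x. \<Sum>m=1..x div d. mangoldt d)"
    by (simp add: mult.commute)
  also have "\<dots> = (\<Sum>n=1..x. \<Sum>d | d dvd n. mangoldt d)"
    by (rule sum_divisors_swap[symmetric])
  also have "\<dots> = (\<Sum>n=1..x. ln (real n))"
    by (intro sum.cong HOL.refl) (auto simp: mangoldt_sum)
  also have "\<dots> = ln (fact x)"
    by (subst ln_prod[symmetric]) (auto simp: fact_prod)
  finally show ?thesis .
qed

lemma ln_fact_le: "ln (fact x) \<le> real x * ln (real x)"
proof (cases "x = 0")
  case False
  have "ln (fact x :: real) \<le> ln (real x ^ x)"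
    using False fact_le_power[of x] by (intro ln_mono) auto
  then show ?thesis using False by (simp add: ln_realpow)
qed auto

text \<open>The induction step needs only \<open>x * (ln (x + 1) - ln x) \<le> 1\<close>. This weak
  form of Stirling's formula suffices for Mertens' estimate.\<close>

lemma ln_fact_ge: "ln (fact x) \<ge> real x * ln (real x) - real x"
proof (induction x)
  case (Suc x)
  show ?case
  proof (cases "x = 0")
    case False
    have "ln (1 + 1 / real x) \<le> 1 / real x"
      by (rule ln_add_one_self_le_self) auto
    moreover have "ln (1 + 1 / real x) = ln (real (Suc x)) - ln (real x)"
      using False ln_div[of "real (Suc x)" "real x"] by (simp add: add_divide_distrib add.commute)
    ultimately have "real x * (ln (real (Suc x)) - ln (real x)) \<le> real x * (1 / real x)"
      by (intro mult_left_mono) auto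
    then have "real x * (ln (real (Suc x)) - ln (real x)) \<le> 1" using False by simp
    moreover have "ln (fact (Suc x) :: real) = ln (real (Suc x)) + ln (fact x)"
      by (simp only: fact_Suc of_nat_mult) (subst ln_mult, auto)
    ultimately show ?thesis using Suc.IH by (simp add: algebra_simps)
  qed auto
qed auto

text \<open>Chebyshev's argument: the logarithm of the central binomial coefficient is at most
  \<open>2 * n\<close>, and it is the sum of \<open>mangoldt d\<close> with coefficients
  \<open>(2*n) div d - 2 * (n div d)\<close>. These are nonnegative, and equal to 1 for
  \<open>n < d \<le> 2*n\<close>.\<close>

lemma sum_mangoldt_doubling:
  "(\<Sum>d=1..2*n. mangoldt d) \<le> (\<Sum>d=1..n. mangoldt d) + 2 * real n"
proof (cases "n = 0")
  case False
  have "ln (real ((2*n) choose n)) \<le> ln (real (2 ^ (2*n)))"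
    using binomial_le_pow2[of "2*n" n] zero_less_binomial[of n "2*n"] by (intro ln_mono) (auto simp del: of_nat_power)
  also have "\<dots> = 2 * real n * ln 2" by (simp add: ln_realpow)
  also have "\<dots> \<le> 2 * real n * 1" using ln_2_less_1 by (intro mult_left_mono) auto
  finally have 1: "ln (real ((2*n) choose n)) \<le> 2 * real n" by simp
  have "real ((2*n) choose n) = fact (2*n) / (fact n * fact n)"
    by (subst binomial_fact) (auto simp: mult_2)
  then have 2: "ln (real ((2*n) choose n)) = ln (fact (2*n)) - 2 * ln (fact n)"
    by (simp add: ln_div ln_mult)
  have 3: "ln (fact n) = (\<Sum>d=1..2*n. mangoldt d * real (n div d))"
    unfolding sum_mangoldt_floor[symmetric] by (rule sum.mono_neutral_left) auto
  have 4: "ln (real ((2*n) choose n)) = (\<Sum>d=1..2*n. mangoldt d * (real ((2*n) div d) - 2 * real (n div d)))"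
    unfolding 2 3 sum_mangoldt_floor[symmetric, of "2*n"]
    by (simp only: sum_distrib_left sum_subtractf right_diff_distrib mult.left_commute)
  have "(\<Sum>d=1..2*n. mangoldt d) - (\<Sum>d=1..n. mangoldt d) = (\<Sum>d\<in>{n<..2*n}. mangoldt d :: real)"
  proof -
    have "{1..2*n} = {1..n} \<union> {n<..2*n}" by auto
    moreover have "sum (mangoldt :: nat \<Rightarrow> real) ({1..n} \<union> {n<..2*n}) = sum mangoldt {1..n} + sum mangoldt {n<..2*n}"
      by (rule sum.union_disjoint) auto
    ultimately show ?thesis by simp
  qed
  also have "\<dots> \<le> (\<Sum>d\<in>{n<..2*n}. mangoldt d * (real ((2*n) div d) - 2 * real (n div d)))"
  proof (intro sum_mono)
    fix d assume d: "d \<in> {n<..2*n}"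
    then have "n div d = 0" "(2*n) div d = 1" by (auto simp: div_nat_eqI)
    then show "mangoldt d \<le> mangoldt d * (real ((2*n) div d) - 2 * real (n div d))" by simp
  qed
  also have "\<dots> \<le> (\<Sum>d=1..2*n. mangoldt d * (real ((2*n) div d) - 2 * real (n div d)))"
  proof (intro sum_mono2)
    fix d
    have "2 * (n div d) \<le> (2*n) div d"
      by (cases "d = 0") (auto simp: less_eq_div_iff_mult_less_eq)
    then have "2 * real (n div d) \<le> real ((2*n) div d)"
      by (metis of_nat_le_iff of_nat_mult of_nat_numeral)
    then show "0 \<le> mangoldt d * (real ((2*n) div d) - 2 * real (n div d))"
      by (simp add: mangoldt_nonneg)
  qed auto
  finally show ?thesis using 1 4 by linarith
qed auto

text \<open>Halving \<open>n\<close> turns the constant 4 into \<open>4 * k + 2 * k\<close>, which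
  leaves room for the one extra term that occurs when \<open>n\<close> is odd.\<close>

lemma sum_mangoldt_le: "(\<Sum>d=1..n. mangoldt d) \<le> 4 * real n"
proof (induction n rule: less_induct)
  case (less n)
  show ?case
  proof (cases "n \<le> 1")
    case True
    then show ?thesis by (cases n) auto
  next
    case False
    define k where "k = n div 2"
    have IH: "(\<Sum>d=1..2*k. mangoldt d) \<le> 6 * real k"
      using less[of k] False sum_mangoldt_doubling[of k] by (simp add: k_def)
    consider "n = 2*k" | "n = Suc (2*k)" unfolding k_def by linarith
    then show ?thesis
    proof cases
      case 1
      then show ?thesis using IH by simp
    next
      case 2
      have "mangoldt (Suc (2*k)) \<le> ln (real (Suc (2*k)))" by (rule mangoldt_le) auto
      also have "\<dots> \<le> 2 * real k" using ln_add_one_self_le_self[of "2 * real k"] by (simp add: add.commute)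
      finally show ?thesis using IH 2 by simp
    qed
  qed
qed

text \<open>Mertens' first estimate: in the formula for \<open>ln (fact x)\<close>, replacing
  \<open>x div d\<close> by the exact quotient changes each term by at most
  \<open>mangoldt d\<close>, and Chebyshev's bound controls the total.\<close>

lemma sum_mangoldt_over_bounds:
  assumes "x > 0"
  shows "ln (real x) - 1 \<le> (\<Sum>d=1..x. mangoldt d / real d)"
    and "(\<Sum>d=1..x. mangoldt d / real d) \<le> ln (real x) + 4"
proof -
  have "ln (fact x) \<le> (\<Sum>d=1..x. mangoldt d * (real x / real d))"
    unfolding sum_mangoldt_floor[symmetric]
    by (intro sum_mono mult_left_mono of_nat_div_le_of_nat) (auto simp: mangoldt_nonneg)
  then have "real x * (ln (real x) - 1) \<le> real x * (\<Sum>d=1..x. mangoldt d / real d)"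
    using ln_fact_ge[of x] by (simp add: sum_distrib_left algebra_simps)
  then show "ln (real x) - 1 \<le> (\<Sum>d=1..x. mangoldt d / real d)"
    using assms by simp
  have "(\<Sum>d=1..x. mangoldt d * (real x / real d - 1)) \<le> ln (fact x)"
    unfolding sum_mangoldt_floor[symmetric]
  proof (intro sum_mono mult_left_mono)
    fix d show "real x / real d - 1 \<le> real (x div d)"
      using floor_divide_of_nat_eq[of x d, where ?'a = real] by linarith
  qed (auto simp: mangoldt_nonneg)
  then have "real x * (\<Sum>d=1..x. mangoldt d / real d) \<le> ln (fact x) + (\<Sum>d=1..x. mangoldt d)"
    by (simp add: sum_distrib_left sum_subtractf algebra_simps)
  also have "\<dots> \<le> real x * (ln (real x) + 4)"
    using ln_fact_le[of x] sum_mangoldt_le[of x] by (simp add: algebra_simps)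
  finally show "(\<Sum>d=1..x. mangoldt d / real d) \<le> ln (real x) + 4"
    using assms by simp
qed

section \<open>Sums of real characters over primes\<close>

text \<open>A nonprincipal real Dirichlet character modulo \<open>M\<close>. As its values are -1, 0
  and 1, being nonprincipal amounts to attaining -1.\<close>

locale real_character =
  fixes M :: nat and \<chi> :: "nat \<Rightarrow> real"
  assumes M_pos: "M > 0"
    and periodic: "\<chi> (n + M) = \<chi> n"
    and mult: "\<chi> (m * n) = \<chi> m * \<chi> n"
    and vals: "\<chi> n = -1 \<or> \<chi> n = 0 \<or> \<chi> n = 1"
    and coprime: "\<chi> n \<noteq> 0 \<longleftrightarrow> coprime n M"
    and nonprincipal: "\<exists>a. \<chi> a = -1"
begin

lemma abs_le_1: "\<bar>\<chi> n\<bar> \<le> 1"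
  using vals[of n] by auto

lemma one: "\<chi> (Suc 0) = 1"
  using mult[of 1 1] coprime[of 1] by auto

lemma power: "\<chi> (n ^ k) = \<chi> n ^ k"
  by (induction k) (auto simp: one mult)

lemma mod_eq: "\<chi> (n mod M) = \<chi> n"
proof -
  have "\<chi> (m + M * k) = \<chi> m" for m k
    by (induction k) (auto simp: periodic simp flip: add.assoc, metis add.assoc add.commute periodic)
  from this[of "n mod M" "n div M"] show ?thesis by simp
qed

text \<open>Multiplication by some \<open>a\<close> with \<open>\<chi> a = -1\<close> permutes the
  residues and negates the sum.\<close>

lemma sum_residues: "(\<Sum>n<M. \<chi> n) = 0"
proof -
  obtain a where a: "\<chi> a = -1" using nonprincipal by blast
  have cop: "coprime a M" using coprime[of a] a by auto
  have inj: "inj_on (\<lambda>n. (a * n) mod M) {..<M}"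
  proof (rule inj_onI)
    fix m n assume mn: "m \<in> {..<M}" "n \<in> {..<M}" "(a * m) mod M = (a * n) mod M"
    then have "[a * m = a * n] (mod M)" by (simp add: cong_def)
    then have "[m = n] (mod M)" using cop by (simp add: cong_mult_lcancel_nat)
    then show "m = n" using mn by (simp add: cong_def)
  qed
  have img: "(\<lambda>n. (a * n) mod M) ` {..<M} = {..<M}"
    using inj M_pos by (intro card_subset_eq) (auto simp: card_image)
  have "(\<Sum>n<M. \<chi> n) = (\<Sum>n<M. \<chi> ((a * n) mod M))"
    using sum.reindex[OF inj, of \<chi>] by (simp add: img o_def)
  also have "\<dots> = - (\<Sum>n<M. \<chi> n)"
    by (simp add: mod_eq mult a sum_negf)
  finally show ?thesis by simp
qed

lemma sum_period: "(\<Sum>n=a..<a+M. \<chi> n) = 0"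
proof (induction a)
  case 0
  then show ?case using sum_residues by (simp add: atLeast0LessThan)
next
  case (Suc a)
  have "(\<Sum>n=a..<a+M. \<chi> n) = \<chi> a + (\<Sum>n=Suc a..<a+M. \<chi> n)"
    using M_pos by (intro sum.atLeast_Suc_lessThan) auto
  moreover have "(\<Sum>n=Suc a..<Suc a+M. \<chi> n) = (\<Sum>n=Suc a..<a+M. \<chi> n) + \<chi> (a + M)"
    using M_pos by simp
  ultimately show ?case using Suc periodic[of a] by simp
qed

text \<open>Full periods cancel, so an incomplete one of at most \<open>M\<close> terms
  remains.\<close>

lemma abs_sum_interval: "\<bar>\<Sum>n=a..<b. \<chi> n\<bar> \<le> real M"
proof (induction "b - a" arbitrary: a rule: less_induct)
  case less
  show ?case
  proof (cases "b \<le> a + M")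
    case True
    have "\<bar>\<Sum>n=a..<b. \<chi> n\<bar> \<le> (\<Sum>n=a..<b. 1)"
      by (intro order.trans[OF sum_abs] sum_mono abs_le_1)
    also have "\<dots> \<le> real M" using True by simp
    finally show ?thesis .
  next
    case False
    have "(\<Sum>n=a..<b. \<chi> n) = (\<Sum>n=a..<a+M. \<chi> n) + (\<Sum>n=a+M..<b. \<chi> n)"
      using False by (intro sum.atLeastLessThan_concat[symmetric]) auto
    then show ?thesis using less[of "a + M"] False M_pos by (simp add: sum_period)
  qed
qed

lemma abs_sum_mult_le:
  assumes "\<And>n. a \<le> n \<Longrightarrow> g (Suc n) \<le> g n" "\<And>n. a \<le> n \<Longrightarrow> 0 \<le> g n"
  shows "\<bar>\<Sum>n=a..<b. \<chi> n * g n\<bar> \<le> real M * g a"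
proof (cases "a \<le> b")
  case True
  show ?thesis
    using assms True by (intro abs_sum_mult_antimono_le abs_sum_interval)
qed (use assms(2)[of a] in auto)

text \<open>The value at 1 of the Dirichlet L-function of \<open>\<chi>\<close>. The series
  converges only conditionally, in its natural order; the shifted index makes it start at 1.\<close>

definition L where "L = (\<Sum>n. \<chi> (Suc n) / real (Suc n))"

lemma abs_tail_le: "\<bar>\<Sum>n=Suc a..b. \<chi> n / real n\<bar> \<le> real M / real (Suc a)"
  using abs_sum_mult_le[of "Suc a" "\<lambda>n. 1 / real n" "Suc b"]
  by (simp add: frac_le atLeastLessThanSuc_atLeastAtMost)

text \<open>The bound on finite tails shows that the partial sums are Cauchy, and it survives the
  passage to their limit.\<close>

lemma L_approx: "\<bar>L - (\<Sum>n=1..x. \<chi> n / real n)\<bar> \<le> real M / real (Suc x)"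
proof -
  define S where "S k = (\<Sum>n=1..k. \<chi> n / real n)" for k
  have diff: "\<bar>S b - S a\<bar> \<le> real M / real (Suc a)" if "a \<le> b" for a b
  proof -
    have "S b = S a + (\<Sum>n=Suc a..b. \<chi> n / real n)"
      using sum.ub_add_nat[of 1 a "\<lambda>n. \<chi> n / real n" "b - a"] that by (simp add: S_def)
    then show ?thesis using abs_tail_le[of a b] by simp
  qed
  have "Cauchy S"
  proof (rule CauchyI)
    fix e :: real assume "e > 0"
    obtain m :: nat where m: "real M / e < real m" using reals_Archimedean2 by blast
    show "\<exists>k. \<forall>a\<ge>k. \<forall>b\<ge>k. norm (S a - S b) < e"
    proof (intro exI allI impI)
      fix a b assume ab: "a \<ge> m" "b \<ge> m"
      have 1: "real M / real (Suc c) < e" if "c \<ge> m" for c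
      proof -
        have "real M < e * real m" using m \<open>e > 0\<close> by (simp add: field_simps)
        also have "\<dots> \<le> e * real (Suc c)" using that \<open>e > 0\<close> by (intro mult_left_mono) auto
        finally show ?thesis by (simp add: field_simps)
      qed
      show "norm (S a - S b) < e"
        using diff[of a b] diff[of b a] 1[OF ab(1)] 1[OF ab(2)] by (cases "a \<le> b") auto
    qed
  qed
  then have "convergent S" by (rule Cauchy_convergent)
  then obtain l where l: "S \<longlonglongrightarrow> l" by (auto simp: convergent_def)
  have S_eq: "S = (\<lambda>k. \<Sum>n<k. \<chi> (Suc n) / real (Suc n))"
    by (rule ext) (simp add: S_def sum.atLeast1_atMost_eq)
  have "L = l"
    unfolding L_def using l by (intro sums_unique[symmetric]) (simp add: sums_def S_eq)
  have "(\<lambda>k. \<bar>S k - S x\<bar>) \<longlonglongrightarrow> \<bar>l - S x\<bar>"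
    by (intro tendsto_intros l)
  then have "\<bar>l - S x\<bar> \<le> real M / real (Suc x)"
    by (rule tendsto_upperbound) (auto intro!: diff eventually_sequentiallyI[of x] simp del: of_nat_Suc)
  then show ?thesis by (simp add: \<open>L = l\<close> S_def)
qed

text \<open>The function \<open>ln x / x\<close> decreases only beyond \<open>exp 1\<close>, which
  is below 3; this is why later sums treat the terms at 1 and 2 separately.\<close>

lemma ln_over_antimono: "3 \<le> n \<Longrightarrow> ln (real (Suc n)) / real (Suc n) \<le> ln (real n) / real n"
proof -
  assume n: "3 \<le> n"
  have "exp 1 \<le> real n" using n exp_le by linarith
  then have 1: "1 \<le> ln (real n)" using n by (subst ln_ge_iff) auto
  have "ln (real (Suc n)) = ln (real n) + ln (1 + 1 / real n)"
    using n ln_div[of "real (Suc n)" "real n"] by (simp add: add_divide_distrib add.commute)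
  moreover have "ln (1 + 1 / real n) \<le> 1 / real n" by (rule ln_add_one_self_le_self) auto
  moreover have "1 / real n \<le> ln (real n) / real n" using 1 n by (simp add: divide_right_mono)
  ultimately have "ln (real (Suc n)) \<le> ln (real n) + ln (real n) / real n" by linarith
  then show ?thesis using n by (simp add: field_simps)
qed

lemma bounded_sum_ln: "\<exists>C. \<forall>x. \<bar>\<Sum>n=1..x. \<chi> n * ln (real n) / real n\<bar> \<le> C"
proof (intro exI allI)
  fix x
  let ?f = "\<lambda>n. \<chi> n * (ln (real n) / real n)"
  have tail: "\<bar>\<Sum>n=3..<Suc x. ?f n\<bar> \<le> real M * (ln 3 / 3)"
    using abs_sum_mult_le[of 3 "\<lambda>n. ln (real n) / real n" "Suc x"] ln_over_antimono by auto
  show "\<bar>\<Sum>n=1..x. \<chi> n * ln (real n) / real n\<bar> \<le> \<bar>?f 1\<bar> + \<bar>?f 2\<bar> + real M * (ln 3 / 3)"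
  proof (cases "x \<ge> 2")
    case True
    have "(\<Sum>n=1..<Suc x. ?f n) = (\<Sum>n=1..<3. ?f n) + (\<Sum>n=3..<Suc x. ?f n)"
      using True by (intro sum.atLeastLessThan_concat[symmetric]) auto
    moreover have "(\<Sum>n=1..<3. ?f n) = ?f 1 + ?f 2" by (simp add: numeral_eq_Suc)
    ultimately have "(\<Sum>n=1..x. ?f n) = ?f 1 + ?f 2 + (\<Sum>n=3..<Suc x. ?f n)"
      by (simp add: atLeastLessThanSuc_atLeastAtMost)
    then show ?thesis using tail by simp
  next
    case False
    have "real M * (ln 3 / 3) \<ge> 0" by simp
    moreover have "x = 0 \<or> x = 1" using False by linarith
    ultimately show ?thesis by auto
  qed
qed

end

section \<open>Elementary sums and the combinatorics of the hyperbola method\<close>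

lemma sqrt_diff_bounds:
  assumes "a \<ge> 0"
  shows "2 * (sqrt (a + 1) - sqrt a) * sqrt a \<le> 1" "1 \<le> 2 * (sqrt (a + 1) - sqrt a) * sqrt (a + 1)"
proof -
  have eq: "(sqrt (a + 1) - sqrt a) * (sqrt (a + 1) + sqrt a) = 1"
    using assms by (simp add: algebra_simps)
  have le: "sqrt a \<le> sqrt (a + 1)" by simp
  have "(sqrt (a + 1) - sqrt a) * (2 * sqrt a) \<le> (sqrt (a + 1) - sqrt a) * (sqrt (a + 1) + sqrt a)"
    using le by (intro mult_left_mono) auto
  then show "2 * (sqrt (a + 1) - sqrt a) * sqrt a \<le> 1" unfolding eq by (simp add: mult_ac)
  have "(sqrt (a + 1) - sqrt a) * (sqrt (a + 1) + sqrt a) \<le> (sqrt (a + 1) - sqrt a) * (2 * sqrt (a + 1))"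
    using le by (intro mult_left_mono) auto
  then show "1 \<le> 2 * (sqrt (a + 1) - sqrt a) * sqrt (a + 1)" unfolding eq by (simp add: algebra_simps)
qed

lemma sum_inverse_sqrt_le: "(\<Sum>e=1..w. 1 / sqrt (real e)) \<le> 2 * sqrt (real w)"
proof (induction w)
  case (Suc w)
  have "1 / sqrt (real (Suc w)) \<le> 2 * (sqrt (real (Suc w)) - sqrt (real w))"
    using sqrt_diff_bounds(2)[of "real w"] by (simp add: field_simps)
  then show ?case using Suc by simp
qed auto

text \<open>The sequence \<open>s\<close> increases, \<open>u\<close> decreases and stays above it,
  and \<open>c\<close> lies between them; their gap at \<open>w\<close> is the error. The real
  \<open>t\<close> close to \<open>w\<close> permits the later use with \<open>w = y^2 div d\<close>
  and \<open>t = y^2 / d\<close>.\<close>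

lemma sum_inverse_sqrt_approx:
  obtains c where "\<And>(w::nat) t::real. 1 \<le> w \<Longrightarrow> real w \<le> t \<Longrightarrow> t \<le> real w + 1 \<Longrightarrow>
    \<bar>(\<Sum>e=1..w. 1 / sqrt (real e)) - 2 * sqrt t - c\<bar> \<le> 2 / sqrt t"
proof -
  define h where "h w = (\<Sum>e=1..w. 1 / sqrt (real e))" for w :: nat
  define s where "s w = h w - 2 * sqrt (real w + 1)" for w
  define u where "u w = h w - 2 * sqrt (real w)" for w
  have hS: "h (Suc w) = h w + 1 / sqrt (real w + 1)" for w by (simp add: h_def add.commute)
  have "incseq s"
  proof (rule incseq_SucI)
    fix w
    have "2 * (sqrt (real w + 2) - sqrt (real w + 1)) \<le> 1 / sqrt (real w + 1)"
      using sqrt_diff_bounds(1)[of "real w + 1"] by (simp add: field_simps)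
    then show "s w \<le> s (Suc w)" by (simp add: s_def hS add.commute)
  qed
  have "decseq u"
  proof (rule decseq_SucI)
    fix w
    have "1 / sqrt (real w + 1) \<le> 2 * (sqrt (real w + 1) - sqrt (real w))"
      using sqrt_diff_bounds(2)[of "real w"] by (simp add: field_simps)
    then show "u (Suc w) \<le> u w" by (simp add: u_def hS add.commute)
  qed
  have su: "s m \<le> u w" for m w
  proof -
    have "s m \<le> s (max m w)" using \<open>incseq s\<close> by (simp add: incseq_def)
    also have "\<dots> \<le> u (max m w)" by (simp add: s_def u_def)
    also have "\<dots> \<le> u w" using \<open>decseq u\<close> by (simp add: decseq_def)
    finally show ?thesis .
  qed
  define c where "c = (SUP m. s m)"
  have sc: "s w \<le> c" for w unfolding c_def using su by (intro cSUP_upper bdd_aboveI[of _ "u 0"]) auto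
  have cu: "c \<le> u w" for w unfolding c_def using su by (intro cSUP_least) auto
  have arith: "\<lbrakk>2 * (b - a) \<le> e; h - 2 * b \<le> k; k \<le> h - 2 * a; a \<le> s; s \<le> b\<rbrakk>
      \<Longrightarrow> \<bar>h - 2 * s - k\<bar> \<le> e" for a b e h k s :: real
    by (simp add: abs_le_iff)
  show thesis
  proof (rule that[of c])
    fix w :: nat and t :: real assume w: "1 \<le> w" "real w \<le> t" "t \<le> real w + 1"
    have st: "sqrt (real w) \<le> sqrt t" "sqrt t \<le> sqrt (real w + 1)" using w by auto
    have "2 * (sqrt (real w + 1) - sqrt (real w)) \<le> 1 / sqrt (real w)"
      using sqrt_diff_bounds(1)[of "real w"] w by (simp add: field_simps)
    also have "sqrt t \<le> sqrt (4 * real w)" using w by (intro real_sqrt_le_mono) auto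
    then have "1 / sqrt (real w) \<le> 2 / sqrt t" using w by (simp add: field_simps real_sqrt_mult)
    finally have "2 * (sqrt (real w + 1) - sqrt (real w)) \<le> 2 / sqrt t" .
    then show "\<bar>(\<Sum>e=1..w. 1 / sqrt (real e)) - 2 * sqrt t - c\<bar> \<le> 2 / sqrt t"
      using arith sc[of w] cu[of w] st unfolding s_def u_def h_def by blast
  qed
qed

lemma ln_le_harmonic: "ln (real (Suc y)) \<le> (\<Sum>m=1..y. 1 / real m)"
proof (induction y)
  case (Suc y)
  have "ln (real (Suc (Suc y))) - ln (real (Suc y)) = ln (1 + 1 / real (Suc y))"
  proof -
    have "1 + 1 / real (Suc y) = real (Suc (Suc y)) / real (Suc y)" by (simp add: field_simps)
    then show ?thesis by (simp only: ln_div) simp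
  qed
  also have "\<dots> \<le> 1 / real (Suc y)" by (rule ln_add_one_self_le_self) auto
  finally show ?case using Suc by simp
qed auto

lemma harmonic_le_ln: "(\<Sum>m=1..y. 1 / real m) \<le> 1 + ln (real (max 1 y))"
proof (induction y)
  case (Suc y)
  show ?case
  proof (cases "y = 0")
    case False
    have "ln (real y / real (Suc y)) \<le> real y / real (Suc y) - 1"
      using False by (intro ln_le_minus_one) auto
    also have "ln (real y / real (Suc y)) = ln (real y) - ln (real (Suc y))"
      using False by (simp add: ln_div)
    also have "real y / real (Suc y) - 1 = - (1 / real (Suc y))" by (simp add: field_simps)
    finally have "1 / real (Suc y) \<le> ln (real (Suc y)) - ln (real y)" by simp
    then show ?thesis using Suc False by (simp add: max_def)
  qed auto
qed auto

text \<open>The descent step for inductions on multiplicative functions.\<close>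

lemma prime_power_decompE:
  fixes n :: nat
  assumes "n > 1"
  obtains p k m where "prime p" "k > 0" "\<not> p dvd m" "m > 0" "m < n" "n = p ^ k * m"
proof -
  obtain p where p: "prime p" "p dvd n" using prime_factor_nat[of n] assms by auto
  obtain k m where m: "n = p ^ k * m" "\<not> p dvd m" and k: "k = multiplicity p n"
  proof (rule multiplicity_decompose'[of n p])
    show "n \<noteq> 0" "\<not> is_unit p" using assms p by auto
  qed (use that in blast)
  have "k > 0"
    using p assms by (simp add: k prime_multiplicity_gt_zero_iff)
  have "m > 0" using m(1) assms by (cases "m = 0") simp_all
  have "1 < p ^ k" using \<open>k > 0\<close> p prime_gt_1_nat by (intro one_less_power) auto
  then have "m < n" unfolding m(1) using \<open>m > 0\<close> by simp
  then show ?thesis using that p(1) \<open>k > 0\<close> m \<open>m > 0\<close> by blast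
qed

text \<open>Both sides describe the pairs with \<open>e * d \<le> y^2\<close> and
  \<open>d > y\<close>, where the first condition forces \<open>e \<le> y\<close>.\<close>

lemma hyperbola_region:
  "d \<in> {Suc y..y^2} \<and> e \<in> {1..y^2 div d} \<longleftrightarrow> e \<in> {1..y} \<and> d \<in> {Suc y..y^2 div e}"
proof (cases "Suc y \<le> d \<and> 1 \<le> e")
  case True
  have 1: "e \<le> y^2 div d \<longleftrightarrow> e * d \<le> y^2" and 2: "d \<le> y^2 div e \<longleftrightarrow> e * d \<le> y^2"
    using True by (auto simp: less_eq_div_iff_mult_less_eq mult.commute)
  have 3: "e \<le> y" if "e * d \<le> y^2"
  proof (rule ccontr)
    assume "\<not> e \<le> y"
    then have "Suc y * Suc y \<le> e * d" using True by (intro mult_le_mono) auto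
    with that show False by (simp add: power2_eq_square)
  qed
  have 4: "d \<le> y^2" if "e * d \<le> y^2"
    using le_of_mult_le[of e d "y^2"] that True by (simp add: mult.commute)
  show ?thesis unfolding atLeastAtMost_iff 1 2 using True 3 4 by blast
qed auto

section \<open>Nonvanishing of \<open>L\<close> and the bounded sum of \<open>\<chi>\<close> over
  primes\<close>

context real_character begin

text \<open>The Dirichlet coefficients of the product of the zeta function and the L-function of
  \<open>\<chi>\<close>.\<close>

definition divisor_sum where "divisor_sum n = (\<Sum>d | d dvd n. \<chi> d)"

lemma divisor_sum_one: "divisor_sum (Suc 0) = 1" by (simp add: divisor_sum_def one)

text \<open>Every divisor of \<open>p ^ k * m\<close> is uniquely \<open>p ^ j * d\<close> with
  \<open>j \<le> k\<close> and \<open>d dvd m\<close>, so the sum factors.\<close>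

lemma divisor_sum_prime_power_mult:
  assumes p: "prime p" and m: "\<not> p dvd m" "m > 0"
  shows "divisor_sum (p ^ k * m) = (\<Sum>j\<le>k. \<chi> p ^ j) * divisor_sum m"
proof -
  have inj: "inj_on (\<lambda>(j,d). p ^ j * d) ({..k} \<times> {d. d dvd m})"
  proof (rule inj_onI, clarify)
    fix j j' d d' assume *: "d dvd m" "d' dvd m" "p ^ j * d = p ^ j' * d'"
    have nd: "\<not> p dvd d" "\<not> p dvd d'" using * m by (auto dest: dvd_trans)
    have "j = j'" using prime_power_cancel[of p d j d' j'] p * nd by (simp add: mult.commute)
    then show "j = j' \<and> d = d'" using * p by auto
  qed
  have img: "{d. d dvd p ^ k * m} = (\<lambda>(j,d). p ^ j * d) ` ({..k} \<times> {d. d dvd m})"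
  proof (intro equalityI subsetI)
    fix d assume "d \<in> {d. d dvd p ^ k * m}"
    then obtain b c where bc: "d = b * c" "b dvd p ^ k" "c dvd m"
      using division_decomp[of d "p ^ k" m] by auto
    obtain j where "j \<le> k" "b = p ^ j" using bc p by (auto simp: divides_primepow_nat)
    then show "d \<in> (\<lambda>(j,d). p ^ j * d) ` ({..k} \<times> {d. d dvd m})" using bc by force
  qed (auto intro!: mult_dvd_mono le_imp_power_dvd)
  have "divisor_sum (p ^ k * m) = (\<Sum>(j,d)\<in>{..k} \<times> {d. d dvd m}. \<chi> (p ^ j * d))"
    unfolding divisor_sum_def img by (subst sum.reindex[OF inj]) (simp add: o_def case_prod_unfold)
  also have "\<dots> = (\<Sum>(j,d)\<in>{..k} \<times> {d. d dvd m}. \<chi> p ^ j * \<chi> d)"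
    by (simp add: mult power)
  also have "\<dots> = (\<Sum>j\<le>k. \<chi> p ^ j) * divisor_sum m"
    unfolding divisor_sum_def by (simp add: sum_product sum.cartesian_product)
  finally show ?thesis .
qed

text \<open>For \<open>\<chi> p = -1\<close> the terms alternate and the sum is 1 or 0 by the parity
  of \<open>k\<close>; for the values 0 and 1 it is 1 and \<open>k + 1\<close>.\<close>

lemma geometric_sum_bounds: "0 \<le> (\<Sum>j\<le>k. \<chi> p ^ j)" "even k \<Longrightarrow> 1 \<le> (\<Sum>j\<le>k. \<chi> p ^ j)"
proof -
  have neg: "(\<Sum>j\<le>k. (-1) ^ j) = (if even k then 1 else 0 :: real)" by (induction k) auto
  have zero: "(\<Sum>j\<le>k. 0 ^ j) = (1 :: real)" by (induction k) auto
  show "0 \<le> (\<Sum>j\<le>k. \<chi> p ^ j)" "even k \<Longrightarrow> 1 \<le> (\<Sum>j\<le>k. \<chi> p ^ j)"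
    using vals[of p] by (auto simp: neg zero)
qed

lemma divisor_sum_nonneg: "n > 0 \<Longrightarrow> divisor_sum n \<ge> 0"
proof (induction n rule: less_induct)
  case (less n)
  show ?case
  proof (cases "n = 1")
    case False
    then obtain p k m where *: "prime p" "k > 0" "\<not> p dvd m" "m > 0" "m < n" "n = p ^ k * m"
      using prime_power_decompE[of n] less.prems by (metis One_nat_def Suc_lessI)
    show ?thesis unfolding *(6) divisor_sum_prime_power_mult[OF *(1,3,4)]
      using less.IH[of m] * by (intro mult_nonneg_nonneg geometric_sum_bounds) auto
  qed (simp add: divisor_sum_one)
qed

lemma divisor_sum_square: "n > 0 \<Longrightarrow> divisor_sum (n ^ 2) \<ge> 1"
proof (induction n rule: less_induct)
  case (less n)
  show ?case
  proof (cases "n = 1")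
    case False
    then obtain p k m where *: "prime p" "k > 0" "\<not> p dvd m" "m > 0" "m < n" "n = p ^ k * m"
      using prime_power_decompE[of n] less.prems by (metis One_nat_def Suc_lessI)
    have nd: "\<not> p dvd m ^ 2" using * by (simp add: prime_dvd_power_iff)
    have "n ^ 2 = p ^ (2 * k) * m ^ 2" using * by (simp add: power_mult_distrib power_mult mult.commute)
    then have "divisor_sum (n ^ 2) = (\<Sum>j\<le>2*k. \<chi> p ^ j) * divisor_sum (m ^ 2)"
      using divisor_sum_prime_power_mult[OF *(1) nd] *(4) by simp
    moreover have "1 * 1 \<le> (\<Sum>j\<le>2*k. \<chi> p ^ j) * divisor_sum (m ^ 2)"
      using less.IH[of m] * by (intro mult_mono geometric_sum_bounds) auto
    ultimately show ?thesis by simp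
  qed (simp add: divisor_sum_one)
qed

text \<open>Dropping all nonsquares loses only nonnegative terms, and each square \<open>m^2\<close>
  contributes at least \<open>1 / m\<close>.\<close>

lemma sum_divisor_sum_lower: "ln (real (Suc y)) \<le> (\<Sum>n=1..y^2. divisor_sum n / sqrt (real n))"
proof -
  have "ln (real (Suc y)) \<le> (\<Sum>m=1..y. 1 / real m)" by (rule ln_le_harmonic)
  also have "\<dots> \<le> (\<Sum>m=1..y. divisor_sum (m^2) / sqrt (real (m^2)))"
    by (intro sum_mono) (auto intro!: divide_right_mono divisor_sum_square)
  also have "\<dots> = (\<Sum>n\<in>(\<lambda>m. m^2) ` {1..y}. divisor_sum n / sqrt (real n))"
    by (subst sum.reindex) (auto simp: inj_on_def)
  also have "\<dots> \<le> (\<Sum>n=1..y^2. divisor_sum n / sqrt (real n))"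
    by (intro sum_mono2) (auto intro!: divide_nonneg_nonneg divisor_sum_nonneg power_mono)
  finally show ?thesis .
qed

text \<open>The pairs with \<open>d * e \<le> y^2\<close> are split at \<open>d = y\<close>. For
  large \<open>d\<close> the order of summation is exchanged, so that the inner sum is over
  \<open>\<chi>\<close> and shows cancellation.\<close>

lemma sum_divisor_sum_hyperbola:
  "(\<Sum>n=1..y^2. divisor_sum n / sqrt (real n))
    = (\<Sum>d=1..y. \<chi> d / sqrt (real d) * (\<Sum>e=1..y^2 div d. 1 / sqrt (real e)))
      + (\<Sum>e=1..y. 1 / sqrt (real e) * (\<Sum>d=Suc y..y^2 div e. \<chi> d / sqrt (real d)))"
proof -
  let ?F = "\<lambda>d e. \<chi> d / sqrt (real d) * (1 / sqrt (real e))"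
  have "(\<Sum>n=1..y^2. divisor_sum n / sqrt (real n)) = (\<Sum>n=1..y^2. \<Sum>d | d dvd n. ?F d (n div d))"
  proof (intro sum.cong HOL.refl)
    fix n assume "n \<in> {1..y^2}"
    have F: "?F d (n div d) = \<chi> d / sqrt (real n)" if "d dvd n" for d
      using that by (auto simp: real_sqrt_mult elim!: dvdE)
    have "(\<Sum>d | d dvd n. ?F d (n div d)) = (\<Sum>d | d dvd n. \<chi> d / sqrt (real n))"
      by (intro sum.cong HOL.refl, rule F) simp
    then show "divisor_sum n / sqrt (real n) = (\<Sum>d | d dvd n. ?F d (n div d))"
      by (simp add: divisor_sum_def sum_divide_distrib)
  qed
  also have "\<dots> = (\<Sum>d=1..y^2. \<Sum>e=1..y^2 div d. ?F d e)" by (rule sum_divisors_swap)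
  also have "\<dots> = (\<Sum>d=1..y. \<Sum>e=1..y^2 div d. ?F d e) + (\<Sum>d=Suc y..y^2. \<Sum>e=1..y^2 div d. ?F d e)"
  proof -
    have "{1..y^2} = {1..y} \<union> {Suc y..y^2}"
      by (auto simp: power2_eq_square intro: le_trans[OF _ le_square])
    then show ?thesis by (simp only:) (rule sum.union_disjoint, auto)
  qed
  also have "(\<Sum>d=Suc y..y^2. \<Sum>e=1..y^2 div d. ?F d e) = (\<Sum>e=1..y. \<Sum>d=Suc y..y^2 div e. ?F d e)"
  proof -
    define S T where "S = Sigma {Suc y..y^2} (\<lambda>d. {1..y^2 div d})" and "T = Sigma {1..y} (\<lambda>e. {Suc y..y^2 div e})"
    have ST: "(d,e) \<in> S \<longleftrightarrow> (e,d) \<in> T" for d e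
      unfolding S_def T_def mem_Sigma_iff by (rule hyperbola_region)
    have "(\<Sum>(d,e)\<in>S. ?F d e) = (\<Sum>(e,d)\<in>T. ?F d e)"
      by (rule sum.reindex_bij_witness[where i = "\<lambda>(e,d). (d,e)" and j = "\<lambda>(d,e). (e,d)"])
        (auto simp: ST)
    then show ?thesis by (simp add: sum.Sigma S_def T_def)
  qed
  finally show ?thesis by (simp add: sum_distrib_left mult.commute)
qed

text \<open>The divisor sum of \<open>\<chi>\<close> is nonnegative and at least 1 on squares, so its sum weighted by the inverse
  square root diverges; if \<open>L = 0\<close>, Dirichlet's hyperbola method shows that it stays bounded.\<close>

lemma L_nonzero: "L \<noteq> 0"
proof
  assume L0: "L = 0"
  obtain c where c: "\<And>(w::nat) t::real. 1 \<le> w \<Longrightarrow> real w \<le> t \<Longrightarrow> t \<le> real w + 1 \<Longrightarrow>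
    \<bar>(\<Sum>e=1..w. 1 / sqrt (real e)) - 2 * sqrt t - c\<bar> \<le> 2 / sqrt t"
    using sum_inverse_sqrt_approx by blast
  have bound: "ln (real (Suc y)) \<le> 4 * real M + \<bar>c\<bar> * real M + 2" if "y > 0" for y
  proof -
    \<comment> \<open>The error of the square root approximation at \<open>t = y^2 / d\<close>,
      whose floor is the number of terms.\<close>
    define err where "err d = (\<Sum>e=1..y^2 div d. 1 / sqrt (real e)) - 2 * sqrt (real (y^2) / real d) - c" for d
    have err: "\<bar>err d\<bar> \<le> 2 * sqrt (real d) / real y" if "d \<in> {1..y}" for d
    proof -
      have "1 \<le> y^2 div d" using that by (auto simp: less_eq_div_iff_mult_less_eq power2_eq_square intro: le_trans[OF _ le_square])
      then have "\<bar>err d\<bar> \<le> 2 / sqrt (real (y^2) / real d)"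
        unfolding err_def using floor_divide_of_nat_eq[of "y^2" d, where ?'a = real] by (intro c) linarith+
      also have "\<dots> = 2 * sqrt (real d) / real y" by (simp add: real_sqrt_divide)
      finally show ?thesis .
    qed
    have "(\<Sum>d=1..y. \<chi> d / sqrt (real d) * (\<Sum>e=1..y^2 div d. 1 / sqrt (real e)))
        = (\<Sum>d=1..y. 2 * real y * (\<chi> d / real d) + c * (\<chi> d / sqrt (real d)) + \<chi> d / sqrt (real d) * err d)"
    proof (intro sum.cong HOL.refl)
      fix d assume "d \<in> {1..y}"
      have "\<chi> d / sqrt (real d) * sqrt (real (y^2) / real d) = real y * (\<chi> d / real d)"
        by (simp add: real_sqrt_divide)
      then show "\<chi> d / sqrt (real d) * (\<Sum>e=1..y^2 div d. 1 / sqrt (real e))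
         = 2 * real y * (\<chi> d / real d) + c * (\<chi> d / sqrt (real d)) + \<chi> d / sqrt (real d) * err d"
        unfolding err_def by (simp add: algebra_simps)
    qed
    also have "\<dots> = 2 * real y * (\<Sum>d=1..y. \<chi> d / real d) + c * (\<Sum>d=1..y. \<chi> d / sqrt (real d))
        + (\<Sum>d=1..y. \<chi> d / sqrt (real d) * err d)"
      by (simp add: sum.distrib sum_distrib_left)
    also have "\<dots> \<le> 2 * real M + \<bar>c\<bar> * real M + 2"
    proof (intro add_mono)
      \<comment> \<open>Here \<open>L = 0\<close> enters: the partial sum is then minus a tail of
        order \<open>1 / y\<close>, which absorbs the factor \<open>2 * real y\<close> of the main
        term.\<close>
      have "\<bar>\<Sum>d=1..y. \<chi> d / real d\<bar> \<le> real M / real (Suc y)" using L_approx[of y] L0 by simp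
      then have "2 * real y * (\<Sum>d=1..y. \<chi> d / real d) \<le> 2 * real y * (real M / real (Suc y))"
        by (intro mult_left_mono) auto
      also have "\<dots> \<le> 2 * real M" by (simp add: field_simps)
      finally show "2 * real y * (\<Sum>d=1..y. \<chi> d / real d) \<le> 2 * real M" .
      have "\<bar>\<Sum>d=1..<Suc y. \<chi> d * (1 / sqrt (real d))\<bar> \<le> real M * (1 / sqrt (real 1))"
        by (intro abs_sum_mult_le) (auto simp: frac_le)
      then have "\<bar>\<Sum>d=1..y. \<chi> d / sqrt (real d)\<bar> \<le> real M"
        by (simp add: atLeastLessThanSuc_atLeastAtMost)
      then have "\<bar>c * (\<Sum>d=1..y. \<chi> d / sqrt (real d))\<bar> \<le> \<bar>c\<bar> * real M"
        unfolding abs_mult by (intro mult_left_mono) auto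
      then show "c * (\<Sum>d=1..y. \<chi> d / sqrt (real d)) \<le> \<bar>c\<bar> * real M" by linarith
      have "\<bar>\<Sum>d=1..y. \<chi> d / sqrt (real d) * err d\<bar> \<le> (\<Sum>d=1..y. 2 / real y)"
      proof (intro order.trans[OF sum_abs] sum_mono)
        fix d assume d: "d \<in> {1..y}"
        have "\<bar>\<chi> d / sqrt (real d) * err d\<bar> \<le> 1 / sqrt (real d) * (2 * sqrt (real d) / real y)"
          unfolding abs_mult using err[OF d] abs_le_1[of d] by (intro mult_mono) (auto simp: divide_right_mono)
        also have "\<dots> = 2 / real y" using d by simp
        finally show "\<bar>\<chi> d / sqrt (real d) * err d\<bar> \<le> 2 / real y" .
      qed
      also have "\<dots> = 2" using \<open>y > 0\<close> by simp
      finally show "(\<Sum>d=1..y. \<chi> d / sqrt (real d) * err d) \<le> 2" by linarith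
    qed
    finally have 1: "(\<Sum>d=1..y. \<chi> d / sqrt (real d) * (\<Sum>e=1..y^2 div d. 1 / sqrt (real e)))
      \<le> 2 * real M + \<bar>c\<bar> * real M + 2" .
    \<comment> \<open>In the second region the inner character sum is of order
      \<open>1 / sqrt y\<close>, which cancels the outer sum of order \<open>sqrt y\<close>.\<close>
    have "(\<Sum>e=1..y. 1 / sqrt (real e) * (\<Sum>d=Suc y..y^2 div e. \<chi> d / sqrt (real d)))
      \<le> (\<Sum>e=1..y. 1 / sqrt (real e) * (real M / sqrt (real (Suc y))))"
    proof (intro sum_mono mult_left_mono)
      fix e
      have "\<bar>\<Sum>d=Suc y..<Suc (y^2 div e). \<chi> d * (1 / sqrt (real d))\<bar> \<le> real M * (1 / sqrt (real (Suc y)))"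
        by (intro abs_sum_mult_le) (auto simp: frac_le)
      then show "(\<Sum>d=Suc y..y^2 div e. \<chi> d / sqrt (real d)) \<le> real M / sqrt (real (Suc y))"
        by (simp add: atLeastLessThanSuc_atLeastAtMost)
    qed auto
    also have "\<dots> = (\<Sum>e=1..y. 1 / sqrt (real e)) * (real M / sqrt (real (Suc y)))"
      by (rule sum_distrib_right[symmetric])
    also have "\<dots> \<le> (2 * sqrt (real (Suc y))) * (real M / sqrt (real (Suc y)))"
      by (intro mult_right_mono order.trans[OF sum_inverse_sqrt_le]) auto
    also have "\<dots> = 2 * real M" by simp
    finally show ?thesis using 1 sum_divisor_sum_lower[of y] unfolding sum_divisor_sum_hyperbola by linarith
  qed
  obtain y :: nat where y: "exp (4 * real M + \<bar>c\<bar> * real M + 2) < real y"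
    using reals_Archimedean2 by blast
  have "y > 0" using y exp_gt_zero less_trans by (metis of_nat_0_less_iff)
  have "4 * real M + \<bar>c\<bar> * real M + 2 < ln (real y)"
    using y \<open>y > 0\<close> by (metis exp_less_cancel_iff exp_ln of_nat_0_less_iff)
  also have "\<dots> \<le> ln (real (Suc y))" using \<open>y > 0\<close> by (intro ln_mono) auto
  finally show False using bound[OF \<open>y > 0\<close>] by linarith
qed

text \<open>Mertens' method: writing \<open>ln\<close> as a divisor sum of \<open>mangoldt\<close>
  turns the bounded sum of \<open>\<chi> n * ln n / n\<close> into one over \<open>d\<close> with
  the inner factors \<open>S (x div d)\<close>. Replacing these by \<open>L\<close> costs a bounded
  amount, by \<open>L_approx\<close> and Chebyshev's bound, and then \<open>L \<noteq> 0\<close> can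
  be divided out.\<close>

lemma sum_mangoldt_bounded: "\<exists>C. \<forall>x. \<bar>\<Sum>d=1..x. \<chi> d * mangoldt d / real d\<bar> \<le> C"
proof -
  obtain C where C: "\<And>x. \<bar>\<Sum>n=1..x. \<chi> n * ln (real n) / real n\<bar> \<le> C"
    using bounded_sum_ln by blast
  have "\<bar>\<Sum>d=1..x. \<chi> d * mangoldt d / real d\<bar> \<le> (C + 4 * real M) / \<bar>L\<bar>" for x
  proof -
    define S where "S k = (\<Sum>m=1..k. \<chi> m / real m)" for k
    let ?T = "\<Sum>d=1..x. \<chi> d * mangoldt d / real d"
    let ?F = "\<lambda>d m. \<chi> d * mangoldt d / real d * (\<chi> m / real m)"
    have "(\<Sum>n=1..x. \<chi> n * ln (real n) / real n) = (\<Sum>n=1..x. \<Sum>d | d dvd n. ?F d (n div d))"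
    proof (intro sum.cong HOL.refl)
      fix n assume n: "n \<in> {1..x}"
      have "?F d (n div d) = \<chi> n / real n * mangoldt d" if "d dvd n" for d
        using that n by (auto simp: mult elim!: dvdE)
      then have "(\<Sum>d | d dvd n. ?F d (n div d)) = \<chi> n / real n * (\<Sum>d | d dvd n. mangoldt d)"
        by (simp add: sum_distrib_left)
      then show "\<chi> n * ln (real n) / real n = (\<Sum>d | d dvd n. ?F d (n div d))"
        using n by (simp add: mangoldt_sum)
    qed
    also have "\<dots> = (\<Sum>d=1..x. \<Sum>m=1..x div d. ?F d m)" by (rule sum_divisors_swap)
    also have "\<dots> = (\<Sum>d=1..x. \<chi> d * mangoldt d / real d * S (x div d))"
      by (simp only: S_def sum_distrib_left)
    finally have sum_eq: "(\<Sum>n=1..x. \<chi> n * ln (real n) / real n)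
        = (\<Sum>d=1..x. \<chi> d * mangoldt d / real d * S (x div d))" .
    define b where "b d = \<chi> d * mangoldt d / real d" for d
    have "(\<Sum>d=1..x. b d * (L - S (x div d))) = (\<Sum>d=1..x. L * b d - b d * S (x div d))"
      by (intro sum.cong HOL.refl) (simp only: right_diff_distrib mult.commute)
    also have "\<dots> = L * (\<Sum>d=1..x. b d) - (\<Sum>d=1..x. b d * S (x div d))"
      by (simp only: sum_subtractf sum_distrib_left)
    finally have eq: "L * ?T - (\<Sum>n=1..x. \<chi> n * ln (real n) / real n)
        = (\<Sum>d=1..x. \<chi> d * mangoldt d / real d * (L - S (x div d)))"
      unfolding sum_eq b_def by (rule HOL.sym)
    have "\<bar>\<Sum>d=1..x. \<chi> d * mangoldt d / real d * (L - S (x div d))\<bar> \<le> (\<Sum>d=1..x. mangoldt d * (real M / real x))"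
    proof (intro order.trans[OF sum_abs] sum_mono)
      fix d assume d: "d \<in> {1..x}"
      have "real x / real d \<le> real (Suc (x div d))"
        using floor_divide_of_nat_eq[of x d, where ?'a = real] by linarith
      then have "real M / real (Suc (x div d)) \<le> real M / (real x / real d)"
        using d by (intro divide_left_mono) auto
      then have 1: "\<bar>L - S (x div d)\<bar> \<le> real M * real d / real x"
        using L_approx[of "x div d"] unfolding S_def by simp
      have "\<bar>\<chi> d * mangoldt d / real d\<bar> \<le> 1 * mangoldt d / real d"
        using abs_le_1[of d] mangoldt_nonneg[of d] by (auto simp: abs_mult intro!: divide_right_mono mult_left_le_one_le)
      then have "\<bar>\<chi> d * mangoldt d / real d * (L - S (x div d))\<bar> \<le> (mangoldt d / real d) * (real M * real d / real x)"
        unfolding abs_mult using 1 by (intro mult_mono) (auto simp: mangoldt_nonneg)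
      then show "\<bar>\<chi> d * mangoldt d / real d * (L - S (x div d))\<bar> \<le> mangoldt d * (real M / real x)"
        using d by simp
    qed
    also have "\<dots> = (\<Sum>d=1..x. mangoldt d) * (real M / real x)" by (rule sum_distrib_right[symmetric])
    also have "\<dots> \<le> 4 * real x * (real M / real x)"
      by (intro mult_right_mono sum_mangoldt_le) auto
    also have "\<dots> \<le> 4 * real M" by simp
    finally have "\<bar>L * ?T\<bar> \<le> C + 4 * real M" using C[of x] eq by linarith
    then show ?thesis using L_nonzero by (simp add: abs_mult field_simps)
  qed
  then show ?thesis by blast
qed

end

section \<open>Passing from the von Mangoldt function to primes\<close>

lemma sum_ln_over_square_le: "(\<Sum>m=2..x. ln (real m) / real m ^ 2) \<le> 4"
proof -
  \<comment> \<open>The subtracted term makes the induction close: since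
    \<open>ln m \<le> 2 * sqrt m\<close>, a new term is at most \<open>2 / (m * sqrt m)\<close>,
    which the growth of the right-hand side covers.\<close>
  have "(\<Sum>m=2..x. ln (real m) / real m ^ 2) \<le> 4 - 4 / sqrt (real x)" if "x \<ge> 1"
    using that
  proof (induction x rule: dec_induct)
    case (step n)
    define a b where "a = sqrt (real n)" and "b = sqrt (real (Suc n))"
    have ab: "a > 0" "b > 0" "a \<le> b" "real (Suc n) = b * b" using step by (auto simp: a_def b_def)
    have "1 \<le> 2 * (b - a) * b"
      using sqrt_diff_bounds(2)[of "real n"] by (simp add: a_def b_def add.commute)
    then have "a \<le> 2 * (b - a) * b * b"
      using ab(2,3) mult_right_mono[of 1 "2 * (b - a) * b" b] by linarith
    then have "1 / (b * b * b) \<le> 2 / a - 2 / b" using ab by (simp add: field_simps)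
    moreover have "ln (real (Suc n)) \<le> 2 * b"
    proof -
      have "ln (real (Suc n)) = 2 * ln b" using ab by (simp add: ln_mult)
      also have "\<dots> \<le> 2 * b" using ln_le_minus_one[of b] ab by simp
      finally show ?thesis .
    qed
    then have "ln (real (Suc n)) / real (Suc n) ^ 2 \<le> 2 * b / (b * b) ^ 2"
      unfolding ab(4)[symmetric] by (intro divide_right_mono) auto
    moreover have "2 * b / (b * b) ^ 2 = 2 * (1 / (b * b * b))" using ab by (simp add: field_simps power2_eq_square)
    ultimately show ?case using step by (simp add: a_def b_def)
  qed auto
  then show ?thesis by (cases "x \<ge> 1") (auto intro: order.trans)
qed

text \<open>Only the powers \<open>p ^ k\<close> with \<open>k \<ge> 2\<close> contribute. For fixed
  \<open>p\<close> they form a geometric series of sum at most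
  \<open>2 * ln p / p^2\<close>.\<close>

lemma sum_mangoldt_nonprime_le:
  "(\<Sum>n\<in>{n\<in>{1..x}. \<not> prime n}. mangoldt n / real n) \<le> 8"
proof -
  let ?B = "{n\<in>{1..x}. \<not> prime n \<and> primepow n}"
  let ?P = "{p\<in>{2..x}. prime p} \<times> {2..x}"
  have "(\<Sum>n\<in>{n\<in>{1..x}. \<not> prime n}. mangoldt n / real n) = (\<Sum>n\<in>?B. mangoldt n / real n :: real)"
    by (intro sum.mono_neutral_right) (auto simp: mangoldt_def)
  also have "\<dots> \<le> (\<Sum>n\<in>(\<lambda>(p,k). p ^ k) ` ?P. mangoldt n / real n)"
  proof (intro sum_mono2)
    show "?B \<subseteq> (\<lambda>(p,k). p ^ k) ` ?P"
    proof
      fix n assume n: "n \<in> ?B"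
      then have "primepow n" by simp
      then obtain p k where pk: "prime p" "k > 0" "n = p ^ k"
        unfolding primepow_def by blast
      have "k \<noteq> 1" using n pk by auto
      moreover have "p ^ 1 \<le> p ^ k" using pk prime_ge_1_nat[of p] by (intro power_increasing) auto
      moreover have "k < n" using pk less_exp[of k] power_mono[of 2 p k] prime_ge_2_nat[of p] by linarith
      ultimately show "n \<in> (\<lambda>(p,k). p ^ k) ` ?P"
        using n pk(1,2) prime_ge_2_nat[of p] unfolding pk(3) by (intro image_eqI[of _ _ "(p,k)"]) auto
    qed
  qed (auto simp: mangoldt_nonneg)
  also have "\<dots> = (\<Sum>(p,k)\<in>?P. mangoldt (p ^ k) / real (p ^ k))"
    by (subst sum.reindex) (auto simp: inj_on_def case_prod_unfold prime_power_inj'')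
  also have "\<dots> = (\<Sum>p\<in>{p\<in>{2..x}. prime p}. \<Sum>k=2..x. mangoldt (p ^ k) / real (p ^ k))"
    by (rule sum.cartesian_product[symmetric])
  also have "\<dots> \<le> (\<Sum>p\<in>{p\<in>{2..x}. prime p}. 2 * (ln (real p) / real p ^ 2))"
  proof (intro sum_mono)
    fix p assume "p \<in> {p\<in>{2..x}. prime p}"
    then have p: "prime p" "p \<ge> 2" by (auto dest: prime_ge_2_nat)
    have "(\<Sum>k=2..x. 1 / real p ^ k) \<le> 2 / real p ^ 2 - 1 / real p ^ x" if "x \<ge> 2"
      using that
    proof (induction x rule: dec_induct)
      case base
      then show ?case using p by (simp add: field_simps power2_eq_square)
    next
      case (step n)
      have "2 / real p ^ Suc n \<le> 1 / real p ^ n" using p by (simp add: field_simps)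
      then show ?case using step by simp
    qed
    then have "(\<Sum>k=2..x. 1 / real p ^ k) \<le> 2 / real p ^ 2"
      by (cases "x \<ge> 2") (auto intro: order.trans)
    then have "ln (real p) * (\<Sum>k=2..x. 1 / real p ^ k) \<le> ln (real p) * (2 / real p ^ 2)"
      using p by (intro mult_left_mono) auto
    then show "(\<Sum>k=2..x. mangoldt (p ^ k) / real (p ^ k)) \<le> 2 * (ln (real p) / real p ^ 2)"
      using p by (simp add: sum_distrib_left mult.commute)
  qed
  also have "\<dots> \<le> (\<Sum>p=2..x. 2 * (ln (real p) / real p ^ 2))"
    by (intro sum_mono2) auto
  also have "\<dots> \<le> 2 * 4"
    unfolding sum_distrib_left[symmetric] by (intro mult_left_mono sum_ln_over_square_le) auto
  finally show ?thesis by simp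
qed

text \<open>Stated for bounded weights so that it serves both a character and the constant
  1.\<close>

lemma sum_mangoldt_primes_diff:
  assumes "\<And>n. \<bar>g n\<bar> \<le> (1::real)"
  shows "\<bar>(\<Sum>n=1..x. g n * mangoldt n / real n) - (\<Sum>p\<in>{p\<in>{1..x}. prime p}. g p * ln (real p) / real p)\<bar> \<le> 8"
proof -
  have "(\<Sum>n=1..x. g n * mangoldt n / real n) = (\<Sum>n\<in>{n\<in>{1..x}. \<not> prime n}. g n * mangoldt n / real n)
      + (\<Sum>n\<in>{n\<in>{1..x}. prime n}. g n * mangoldt n / real n)"
    by (subst sum.union_disjoint[symmetric]) (auto intro!: sum.cong)
  moreover have "\<bar>\<Sum>n\<in>{n\<in>{1..x}. \<not> prime n}. g n * mangoldt n / real n\<bar> \<le> 8"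
  proof (rule order.trans[OF sum_abs], rule order.trans[OF sum_mono sum_mangoldt_nonprime_le[of x]])
    fix n
    show "\<bar>g n * mangoldt n / real n\<bar> \<le> mangoldt n / real n"
      using assms[of n] mangoldt_nonneg[of n] mult_right_mono[of "\<bar>g n\<bar>" 1 "mangoldt n"]
      by (auto simp: abs_mult intro!: divide_right_mono)
  qed
  ultimately show ?thesis by simp
qed

lemma (in real_character) sum_primes_bounded:
  "\<exists>C. \<forall>x. \<bar>\<Sum>p\<in>{p\<in>{1..x}. prime p}. \<chi> p * ln (real p) / real p\<bar> \<le> C"
proof -
  obtain C where C: "\<And>x. \<bar>\<Sum>d=1..x. \<chi> d * mangoldt d / real d\<bar> \<le> C"
    using sum_mangoldt_bounded by blast
  have "\<bar>\<Sum>p\<in>{p\<in>{1..x}. prime p}. \<chi> p * ln (real p) / real p\<bar> \<le> C + 8" for x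
    using C[of x] sum_mangoldt_primes_diff[of \<chi> x, OF abs_le_1] by linarith
  then show ?thesis by blast
qed

lemma sum_primes_bounds:
  assumes "x > 0"
  shows "ln (real x) - 9 \<le> (\<Sum>p\<in>{p\<in>{1..x}. prime p}. ln (real p) / real p)"
    and "(\<Sum>p\<in>{p\<in>{1..x}. prime p}. ln (real p) / real p) \<le> ln (real x) + 12"
  using sum_mangoldt_over_bounds[OF assms] sum_mangoldt_primes_diff[of "\<lambda>_. 1" x] by simp_all

section \<open>Primes avoiding residue classes\<close>

text \<open>Both sides agree modulo \<open>l\<close> by Euler's criterion and differ by at most 2,
  which is less than \<open>l\<close>.\<close>

lemma Legendre_mult:
  assumes "prime l" "2 < l"
  shows "Legendre (a * b) (int l) = Legendre a (int l) * Legendre b (int l)"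
proof -
  let ?L = "\<lambda>a. Legendre a (int l)"
  have e: "[?L a = a ^ ((l - 1) div 2)] (mod int l)" for a
    using euler_criterion[of l a] assms by simp
  have "[?L (a * b) = (a * b) ^ ((l - 1) div 2)] (mod int l)" by (rule e)
  moreover have "[?L a * ?L b = (a * b) ^ ((l - 1) div 2)] (mod int l)"
    unfolding power_mult_distrib by (intro cong_mult e)
  ultimately have "[?L (a * b) = ?L a * ?L b] (mod int l)"
    by (meson cong_sym cong_trans)
  then have dvd: "int l dvd ?L (a * b) - ?L a * ?L b" by (simp add: cong_iff_dvd_diff)
  have "\<bar>?L (a * b) - ?L a * ?L b\<bar> \<le> 2" by (auto simp: Legendre_def)
  then have "\<bar>?L (a * b) - ?L a * ?L b\<bar> < int l" using assms by linarith
  then show ?thesis using dvd zdvd_not_zless[of "\<bar>?L (a * b) - ?L a * ?L b\<bar>" "int l"] by auto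
qed

text \<open>Otherwise squaring would be surjective, hence injective, on the nonzero residues,
  although 1 and \<open>l - 1\<close> have the same square.\<close>

lemma ex_Legendre_minus_one:
  assumes "prime l" "2 < (l::nat)"
  shows "\<exists>a::nat. Legendre (int a) (int l) = -1"
proof (rule ccontr)
  assume none: "\<nexists>a::nat. Legendre (int a) (int l) = -1"
  let ?f = "\<lambda>x. x^2 mod l"
  have "{1..<l} \<subseteq> ?f ` {1..<l}"
  proof
    fix a assume a: "a \<in> {1..<l}"
    have "\<not> [int a = 0] (mod int l)" using a by (auto simp: cong_0_iff zdvd_not_zless)
    then have "QuadRes (int l) (int a)" using none unfolding Legendre_def by (metis (full_types))
    then obtain y where y: "[y^2 = int a] (mod int l)" unfolding QuadRes_def by blast
    define x where "x = nat (y mod int l)"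
    have x: "int x = y mod int l" using assms by (simp add: x_def)
    have "int (x^2 mod l) = int (a mod l)"
      using y by (simp add: x zmod_int power_mod cong_def)
    then have fx: "x^2 mod l = a" using a by simp
    have "x < l" using x assms by (metis of_nat_0_less_iff of_nat_less_iff pos_mod_bound prime_gt_0_nat)
    moreover have "x \<noteq> 0" using fx a by (cases "x = 0") auto
    ultimately show "a \<in> ?f ` {1..<l}" using fx by (intro image_eqI[of _ _ x]) auto
  qed
  then have "card {1..<l} \<le> card (?f ` {1..<l})" by (intro card_mono) auto
  then have inj: "inj_on ?f {1..<l}" by (intro eq_card_imp_inj_on antisym card_image_le) auto
  have "?f (l - 1) = ?f 1"
  proof -
    obtain k where k: "l = k + 2" using assms by (metis add.commute le_Suc_ex less_imp_le)
    have "(l - 1)^2 = 1 + k * l" unfolding k by (simp add: power2_eq_square algebra_simps)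
    then show ?thesis by (simp only: mod_mult_self1 power_one)
  qed
  then have "l - 1 = 1" using inj_onD[OF inj, of "l - 1" 1] assms by auto
  then show False using assms by linarith
qed

text \<open>A family of characters indexed by the modulus: index 4 gives the nonprincipal character
  modulo 4, an odd prime its Legendre symbol.\<close>

definition quadratic_character :: "nat \<Rightarrow> nat \<Rightarrow> real" where
  "quadratic_character i n =
    (if i = 4 then (if n mod 4 = 1 then 1 else if n mod 4 = 3 then -1 else 0)
     else of_int (Legendre (int n) (int i)))"

definition character_modulus :: "nat \<Rightarrow> bool" where
  "character_modulus i \<longleftrightarrow> i = 4 \<or> prime i \<and> odd i"

lemma character_modulus_gt_2: "character_modulus i \<Longrightarrow> prime i \<Longrightarrow> 2 < i"
  unfolding character_modulus_def using prime_ge_2_nat[of i] by (cases "i = 2") auto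

lemma character_modulus_pos: "character_modulus i \<Longrightarrow> 0 < i"
  unfolding character_modulus_def by (auto dest: prime_gt_0_nat)

lemma coprime_character_moduli:
  assumes "character_modulus i" "character_modulus j" "i \<noteq> j"
  shows "coprime i j"
proof -
  have "coprime 4 k" if "odd k" for k :: nat
    using that coprime_power_left_iff[of 2 2 k] by simp
  with assms show ?thesis
    unfolding character_modulus_def by (auto simp: primes_coprime coprime_commute)
qed

lemma quadratic_character_mod:
  "character_modulus i \<Longrightarrow> quadratic_character i (n mod i) = quadratic_character i n"
proof -
  have "Legendre (int (n mod i)) (int i) = Legendre (int n) (int i)"
    unfolding Legendre_def QuadRes_def zmod_int by (simp add: cong_def)
  then show ?thesis unfolding quadratic_character_def by simp
qed

lemma quadratic_character_mult:
  assumes "character_modulus i"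
  shows "quadratic_character i (m * n) = quadratic_character i m * quadratic_character i n"
proof (cases "i = 4")
  case True
  let ?q = "quadratic_character 4"
  have mod: "?q (k mod 4) = ?q k" for k
    using quadratic_character_mod[OF assms] True by simp
  have "?q 0 = 0" "?q 1 = 1" "?q 2 = 0" "?q 3 = -1" "?q 4 = 0" "?q 6 = 0" "?q 9 = 1"
    unfolding quadratic_character_def by simp_all
  then have "?q (a * b) = ?q a * ?q b" if "a \<in> {0,1,2,3}" "b \<in> {0,1,2,3}" for a b
    using that by (elim insertE emptyE) simp_all
  moreover have "k mod 4 \<in> {0,1,2,3}" for k :: nat by auto
  ultimately have "?q ((m mod 4) * (n mod 4)) = ?q (m mod 4) * ?q (n mod 4)" by blast
  moreover have "?q ((m mod 4) * (n mod 4)) = ?q (m * n)"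
    using mod[of "(m mod 4) * (n mod 4)"] mod[of "m * n"] mod_mult_eq[of m 4 n] by metis
  ultimately show ?thesis unfolding True mod by simp
next
  case False
  then have "prime i" using assms by (simp add: character_modulus_def)
  then show ?thesis
    using False Legendre_mult character_modulus_gt_2[OF assms] by (simp add: quadratic_character_def)
qed

lemma quadratic_character_vals:
  "quadratic_character i n = -1 \<or> quadratic_character i n = 0 \<or> quadratic_character i n = 1"
  by (auto simp: quadratic_character_def Legendre_def)

lemma quadratic_character_nonzero_iff:
  assumes "character_modulus i"
  shows "quadratic_character i n \<noteq> 0 \<longleftrightarrow> coprime n i"
proof (cases "i = 4")
  case True
  have "coprime n 4 \<longleftrightarrow> odd n" using coprime_power_right_iff[of n 2 2] by simp
  also have "\<dots> \<longleftrightarrow> n mod 4 = 1 \<or> n mod 4 = 3" by presburger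
  finally show ?thesis by (simp add: quadratic_character_def True)
next
  case False
  then have "prime i" using assms by (simp add: character_modulus_def)
  then have "coprime n i \<longleftrightarrow> \<not> i dvd n"
    by (metis coprime_commute prime_imp_coprime_nat coprime_absorb_left not_prime_unit)
  then show ?thesis using False
    by (simp add: quadratic_character_def Legendre_def cong_0_iff)
qed

lemma quadratic_character_one: "character_modulus i \<Longrightarrow> quadratic_character i 1 = 1"
  using quadratic_character_mult[of i 1 1] quadratic_character_nonzero_iff[of i 1] by simp

lemma ex_quadratic_character_minus_one:
  assumes "character_modulus i"
  shows "\<exists>a. quadratic_character i a = -1"
proof (cases "i = 4")
  case True
  show ?thesis unfolding quadratic_character_def True by (rule exI[of _ 3]) simp
next
  case False
  then have "prime i" using assms by (simp add: character_modulus_def)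
  then obtain a where "Legendre (int a) (int i) = -1"
    using ex_Legendre_minus_one[of i] character_modulus_gt_2[OF assms] by blast
  then have "quadratic_character i a = -1" using False by (simp add: quadratic_character_def)
  then show ?thesis by blast
qed

lemma quadratic_character_cong:
  "character_modulus i \<Longrightarrow> [m = n] (mod i) \<Longrightarrow> quadratic_character i m = quadratic_character i n"
  by (metis cong_def quadratic_character_mod)

text \<open>Such products arise on expanding the weight that selects good primes. They are
  nonprincipal by the Chinese remainder theorem, which yields an \<open>a\<close> with value -1 at
  one modulus and 1 at all others.\<close>

lemma real_character_prod:
  assumes "finite S" "S \<noteq> {}" and S: "\<And>i. i \<in> S \<Longrightarrow> character_modulus i"
  shows "real_character (\<Prod>S) (\<lambda>n. \<Prod>i\<in>S. quadratic_character i n)"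
proof
  show "\<Prod>S > 0" using S character_modulus_pos by (intro prod_pos) auto
  show "(\<Prod>i\<in>S. quadratic_character i (n + \<Prod>S)) = (\<Prod>i\<in>S. quadratic_character i n)" for n
  proof (intro prod.cong HOL.refl quadratic_character_cong S)
    fix i assume "i \<in> S"
    then have "i dvd \<Prod>S" using assms by (intro dvd_prodI) auto
    then show "[n + \<Prod>S = n] (mod i)" by (auto simp: cong_def elim!: dvdE)
  qed
  show "(\<Prod>i\<in>S. quadratic_character i (m * n))
      = (\<Prod>i\<in>S. quadratic_character i m) * (\<Prod>i\<in>S. quadratic_character i n)" for m n
    unfolding prod.distrib[symmetric] by (intro prod.cong HOL.refl quadratic_character_mult S)
  show "(\<Prod>i\<in>S. quadratic_character i n) = -1 \<or> (\<Prod>i\<in>S. quadratic_character i n) = 0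
      \<or> (\<Prod>i\<in>S. quadratic_character i n) = 1" for n
    using \<open>finite S\<close>
  proof (induction rule: finite_induct)
    case (insert i S)
    then show ?case using quadratic_character_vals[of i n] by auto
  qed auto
  show "(\<Prod>i\<in>S. quadratic_character i n) \<noteq> 0 \<longleftrightarrow> coprime n (\<Prod>S)" for n
  proof -
    have "coprime n (\<Prod>S) \<longleftrightarrow> (\<forall>i\<in>S. coprime n i)"
      using \<open>finite S\<close> by (induction rule: finite_induct) auto
    then show ?thesis using \<open>finite S\<close> S quadratic_character_nonzero_iff by auto
  qed
  show "\<exists>a. (\<Prod>i\<in>S. quadratic_character i a) = -1"
  proof -
    obtain i where i: "i \<in> S" using \<open>S \<noteq> {}\<close> by blast
    obtain b where b: "quadratic_character i b = -1"
      using ex_quadratic_character_minus_one S i by blast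
    have "coprime i (\<Prod>(S - {i}))"
      using S i coprime_character_moduli by (intro prod_coprime_right) auto
    then obtain a where a: "[a = b] (mod i)" "[a = 1] (mod \<Prod>(S - {i}))"
      using binary_chinese_remainder_nat[of i "\<Prod>(S - {i})" b 1] by blast
    have "quadratic_character j a = 1" if j: "j \<in> S - {i}" for j
    proof -
      have "j dvd \<Prod>(S - {i})" using j \<open>finite S\<close> by (intro dvd_prodI) auto
      then have "[a = 1] (mod j)" using a(2) cong_dvd_modulus_nat by blast
      then show ?thesis
        using quadratic_character_cong[of j a 1] S j quadratic_character_one[of j] by auto
    qed
    then have "(\<Prod>j\<in>S - {i}. quadratic_character j a) = 1" by (intro prod.neutral) auto
    moreover have "quadratic_character i a = -1"
      using quadratic_character_cong[OF S[OF i] a(1)] b by simp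
    ultimately have "(\<Prod>j\<in>S. quadratic_character j a) = -1"
      using prod.remove[OF \<open>finite S\<close> i, of "\<lambda>j. quadratic_character j a"] by simp
    then show ?thesis by blast
  qed
qed

section \<open>Lower bounds for sums over good primes\<close>

definition good_prime :: "nat \<Rightarrow> nat \<Rightarrow> bool" where
  "good_prime N p \<longleftrightarrow> prime p \<and> p > N + 4 \<and> gcd N (p - 1) dvd 2"

text \<open>If 4 or an odd prime \<open>l\<close> divided the gcd, then \<open>p\<close> would be 1
  modulo it and the corresponding character would take the value 1 at \<open>p\<close>.\<close>

lemma good_primeI:
  assumes "N > 0" "prime p" "p > N + 4"
    and "quadratic_character 4 p \<noteq> 1"
    and chi: "\<And>l. prime l \<Longrightarrow> odd l \<Longrightarrow> l dvd N \<Longrightarrow> quadratic_character l p \<noteq> 1"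
  shows "good_prime N p"
proof -
  define g where "g = gcd N (p - 1)"
  have g: "g dvd N" "g dvd p - 1" "g > 0" using assms by (auto simp: g_def)
  have no_odd: "\<not> l dvd g" if l: "prime l" "odd l" for l
  proof
    assume "l dvd g"
    then have "l dvd N" "l dvd p - 1" using g dvd_trans by blast+
    then have "[p = 1] (mod l)" using assms(3) by (simp add: cong_altdef_nat)
    moreover have "character_modulus l" using l by (simp add: character_modulus_def)
    ultimately have "quadratic_character l p = 1"
      using quadratic_character_cong quadratic_character_one by metis
    then show False using chi l \<open>l dvd N\<close> by blast
  qed
  have odd1: "h = 1" if "odd h" "h dvd g" for h
  proof (rule ccontr)
    assume "h \<noteq> 1"
    then obtain l where "prime l" "l dvd h" using prime_factor_nat by blast
    then show False using no_odd that by (meson dvd_trans)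
  qed
  have "\<not> 4 dvd g"
  proof
    assume "4 dvd g"
    then have "4 dvd p - 1" using g dvd_trans by blast
    then have "p mod 4 = 1" using assms(3) by presburger
    then show False using assms(4) by (simp add: quadratic_character_def)
  qed
  have "g dvd 2"
  proof (cases "even g")
    case True
    then obtain h where h: "g = 2 * h" by blast
    then have "odd h" using \<open>\<not> 4 dvd g\<close> by auto
    then show ?thesis using odd1[of h] h by simp
  qed (use odd1[of g] in simp)
  then show ?thesis using assms by (simp add: good_prime_def g_def)
qed

text \<open>The weight \<open>w p\<close> lies between 0 and \<open>2 ^ card I\<close> and vanishes
  at large primes that fail the criterion of \<open>good_primeI\<close>. Expanded over the subsets
  of \<open>I\<close>, its sum consists of Mertens' main term \<open>ln x\<close> from the empty set
  and of bounded sums of nonprincipal characters.\<close>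

lemma sum_good_primes_ge:
  assumes "N > 0"
  obtains c C where "c > 0"
    "\<And>x. x > 0 \<Longrightarrow> c * ln (real x) - C \<le> (\<Sum>p\<in>{p\<in>{1..x}. good_prime N p}. ln (real p) / real p)"
proof -
  define I where "I = insert 4 {l. prime l \<and> odd l \<and> l dvd N}"
  have "finite {l. l dvd N}" using assms by simp
  then have "finite I" unfolding I_def by (auto intro: finite_subset[of _ "{l. l dvd N}"])
  have I: "character_modulus i" if "i \<in> I" for i using that by (auto simp: I_def character_modulus_def)
  define w where "w p = (\<Prod>i\<in>I. 1 - quadratic_character i p)" for p
  let ?P = "\<lambda>x. {p\<in>{1..x}. prime p}"
  let ?S = "\<lambda>S x. \<Sum>p\<in>?P x. (\<Prod>i\<in>S. quadratic_character i p) * ln (real p) / real p"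
  have w_eq: "w p = (\<Sum>S\<in>Pow I. (-1) ^ card S * (\<Prod>i\<in>S. quadratic_character i p))" for p
    unfolding w_def using prod_diff_conv_sum[OF \<open>finite I\<close>, of "\<lambda>_. 1" "\<lambda>i. quadratic_character i p"]
    by (simp only: prod.neutral_const mult_1_right)
  have w_nonneg: "0 \<le> w p" for p
    unfolding w_def proof (intro prod_nonneg)
    show "0 \<le> 1 - quadratic_character i p" for i using quadratic_character_vals[of i p] by auto
  qed
  have w_le: "w p \<le> 2 ^ card I" for p
  proof -
    have "w p \<le> (\<Prod>i\<in>I. 2)"
      unfolding w_def
    proof (intro prod_mono conjI)
      fix i
      show "0 \<le> 1 - quadratic_character i p" "1 - quadratic_character i p \<le> 2"
        using quadratic_character_vals[of i p] by auto
    qed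
    then show ?thesis by simp
  qed
  have "\<exists>C. \<forall>x. \<bar>?S S x\<bar> \<le> C" if "S \<in> Pow I - {{}}" for S
  proof -
    have "finite S" using that \<open>finite I\<close> by (auto intro: finite_subset)
    then interpret real_character "\<Prod>S" "\<lambda>n. \<Prod>i\<in>S. quadratic_character i n"
      using that I by (intro real_character_prod) auto
    show ?thesis by (rule sum_primes_bounded)
  qed
  then have "\<exists>C. \<forall>S\<in>Pow I - {{}}. \<forall>x. \<bar>?S S x\<bar> \<le> C S" by (intro bchoice ballI)
  then obtain C where C: "\<And>S x. S \<in> Pow I - {{}} \<Longrightarrow> \<bar>?S S x\<bar> \<le> C S" by blast
  have main: "ln (real x) - 9 - (\<Sum>S\<in>Pow I - {{}}. C S) \<le> (\<Sum>p\<in>?P x. w p * ln (real p) / real p)" if "x > 0" for x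
  proof -
    have "(\<Sum>p\<in>?P x. w p * ln (real p) / real p)
        = (\<Sum>p\<in>?P x. \<Sum>S\<in>Pow I. (-1) ^ card S * ((\<Prod>i\<in>S. quadratic_character i p) * ln (real p) / real p))"
      by (intro sum.cong HOL.refl)
        (simp only: w_eq sum_distrib_right sum_divide_distrib mult.assoc times_divide_eq_right)
    also have "\<dots> = (\<Sum>S\<in>Pow I. \<Sum>p\<in>?P x. (-1) ^ card S * ((\<Prod>i\<in>S. quadratic_character i p) * ln (real p) / real p))"
      by (rule sum.swap)
    also have "\<dots> = (\<Sum>S\<in>Pow I. (-1) ^ card S * ?S S x)"
      by (simp only: sum_distrib_left)
    also have "\<dots> = ?S {} x + (\<Sum>S\<in>Pow I - {{}}. (-1) ^ card S * ?S S x)"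
      using \<open>finite I\<close> by (subst sum.remove[of _ "{}"]) auto
    finally have eq: "(\<Sum>p\<in>?P x. w p * ln (real p) / real p)
      = ?S {} x + (\<Sum>S\<in>Pow I - {{}}. (-1) ^ card S * ?S S x)" .
    have "\<bar>\<Sum>S\<in>Pow I - {{}}. (-1) ^ card S * ?S S x\<bar> \<le> (\<Sum>S\<in>Pow I - {{}}. C S)"
    proof (intro order.trans[OF sum_abs] sum_mono)
      fix S assume "S \<in> Pow I - {{}}"
      then show "\<bar>(-1) ^ card S * ?S S x\<bar> \<le> C S" using C[of S x] by (simp add: abs_mult power_abs)
    qed
    moreover have "ln (real x) - 9 \<le> ?S {} x" using sum_primes_bounds(1)[OF that] by simp
    ultimately show ?thesis unfolding eq by linarith
  qed
  \<comment> \<open>Primes up to \<open>N + 4\<close> are not good but may have positive weight;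
    they contribute a constant.\<close>
  define D where "D = (\<Sum>p\<in>?P (N + 4). ln (real p) / real p)"
  have upper: "(\<Sum>p\<in>?P x. w p * ln (real p) / real p)
      \<le> 2 ^ card I * ((\<Sum>p\<in>{p\<in>{1..x}. good_prime N p}. ln (real p) / real p) + D)" for x
  proof -
    let ?G = "{p\<in>{1..x}. good_prime N p}"
    have w0: "w p = 0" if "prime p" "p > N + 4" "\<not> good_prime N p" for p
    proof -
      have "\<exists>i\<in>I. quadratic_character i p = 1"
        using good_primeI[of N p] that assms unfolding I_def by blast
      then show ?thesis unfolding w_def using \<open>finite I\<close> by auto
    qed
    have "(\<Sum>p\<in>?P x. w p * ln (real p) / real p) = (\<Sum>p\<in>?P x \<inter> (?G \<union> ?P (N + 4)). w p * ln (real p) / real p)"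
    proof (rule sum.mono_neutral_right)
      show "\<forall>p\<in>?P x - ?P x \<inter> (?G \<union> ?P (N + 4)). w p * ln (real p) / real p = 0"
      proof
        fix p assume "p \<in> ?P x - ?P x \<inter> (?G \<union> ?P (N + 4))"
        then have "w p = 0" by (intro w0) auto
        then show "w p * ln (real p) / real p = 0" by simp
      qed
    qed auto
    also have "\<dots> \<le> (\<Sum>p\<in>?G \<union> ?P (N + 4). w p * ln (real p) / real p)"
      using w_nonneg by (intro sum_mono2) (auto intro!: divide_nonneg_nonneg mult_nonneg_nonneg)
    also have "\<dots> \<le> (\<Sum>p\<in>?G \<union> ?P (N + 4). 2 ^ card I * (ln (real p) / real p))"
      using w_le by (intro sum_mono) (auto intro!: divide_right_mono mult_right_mono)
    also have "\<dots> = 2 ^ card I * (\<Sum>p\<in>?G \<union> ?P (N + 4). ln (real p) / real p)"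
      by (rule sum_distrib_left[symmetric])
    also have "(\<Sum>p\<in>?G \<union> ?P (N + 4). ln (real p) / real p) = (\<Sum>p\<in>?G. ln (real p) / real p) + D"
      unfolding D_def by (intro sum.union_disjoint) (auto simp: good_prime_def)
    finally show ?thesis .
  qed
  show thesis
  proof (rule that[of "1 / 2 ^ card I" "(9 + (\<Sum>S\<in>Pow I - {{}}. C S)) / 2 ^ card I + D"])
    fix x :: nat assume x: "x > 0"
    have arith: "1 / k * b - ((9 + s) / k + d) \<le> g" if "b - 9 - s \<le> k * (g + d)" "k > 0" for b s k g d :: real
      using that by (simp add: field_simps)
    show "1 / 2 ^ card I * ln (real x) - ((9 + (\<Sum>S\<in>Pow I - {{}}. C S)) / 2 ^ card I + D)
        \<le> (\<Sum>p\<in>{p\<in>{1..x}. good_prime N p}. ln (real p) / real p)"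
      by (rule arith[OF order.trans[OF main[OF x] upper]]) simp
  qed simp
qed

text \<open>With \<open>c * B \<ge> 2\<close>, the sum of \<open>ln p / p\<close> over
  \<open>P\<close> up to \<open>u ^ B\<close> is at least about \<open>2 * ln u\<close>, while all
  primes up to \<open>u\<close> give at most \<open>ln u + 12\<close>. The surplus lies in the block
  above \<open>u\<close>, where \<open>ln p \<le> B * ln u\<close> converts it into
  reciprocals.\<close>

lemma block_reciprocal_sum:
  fixes P :: "nat set"
  assumes P: "\<And>p. p \<in> P \<Longrightarrow> prime p" and "c > 0"
    and lower: "\<And>x. x > 0 \<Longrightarrow> c * ln (real x) - C \<le> (\<Sum>p\<in>{p\<in>{1..x}. p \<in> P}. ln (real p) / real p)"
  shows "\<exists>B U. B \<ge> (2::nat) \<and> U \<ge> (2::nat) \<and>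
    (\<forall>u\<ge>U. 1 / (2 * real B) \<le> (\<Sum>p\<in>{p\<in>{u<..u^B}. p \<in> P}. 1 / real p))"
proof -
  define B where "B = nat \<lceil>2 / c\<rceil> + 2"
  have "2 / c \<le> real B" unfolding B_def by linarith
  then have B: "2 \<le> c * real B" using \<open>c > 0\<close> by (simp add: field_simps)
  have B2: "B \<ge> 2" by (simp add: B_def)
  have final: "1 / (2 * b) \<le> t" if "l / 2 \<le> b * l * t" "l > 0" "b > 0" for b l t :: real
  proof -
    have "l * 1 \<le> l * (2 * b * t)" using that(1) by (simp add: mult_ac)
    then have "1 \<le> 2 * b * t" using that(2) by (simp only: mult_le_cancel_left_pos)
    then show ?thesis using that(3) by (simp add: field_simps)
  qed
  \<comment> \<open>Beyond this bound the constants \<open>C\<close> and 12 use up at most half of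
    the surplus \<open>ln u\<close>.\<close>
  obtain U where U: "real U > exp (2 * \<bar>C\<bar> + 24)" using reals_Archimedean2 by blast
  show ?thesis
  proof (rule exI[of _ B], rule exI[of _ "U + 2"], intro conjI allI impI)
    fix u assume u: "u \<ge> U + 2"
    then have u0: "u > 0" "u \<ge> 2" by auto
    have "exp (2 * \<bar>C\<bar> + 24) \<le> real u" using U u by linarith
    then have lnu: "2 * \<bar>C\<bar> + 24 \<le> ln (real u)" using u0 by (simp add: ln_ge_iff)
    let ?S = "\<lambda>x. \<Sum>p\<in>{p\<in>{1..x}. p \<in> P}. ln (real p) / real p"
    have "u \<le> u ^ B" using u0 B2 by (intro self_le_power) auto
    have "?S u \<le> (\<Sum>p\<in>{p\<in>{1..u}. prime p}. ln (real p) / real p)"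
      using P by (intro sum_mono2) auto
    also have "\<dots> \<le> ln (real u) + 12" by (rule sum_primes_bounds(2)) (use u0 in auto)
    finally have 1: "?S u \<le> ln (real u) + 12" .
    have "c * real B * ln (real u) - C \<le> ?S (u ^ B)"
      using lower[of "u ^ B"] u0 by (simp add: ln_realpow mult.assoc)
    moreover have "2 * ln (real u) \<le> c * real B * ln (real u)"
      using B u0 by (intro mult_right_mono) auto
    ultimately have 2: "2 * ln (real u) - C \<le> ?S (u ^ B)" by linarith
    have "?S (u ^ B) = (\<Sum>p\<in>{p\<in>{1..u}. p \<in> P} \<union> {p\<in>{u<..u^B}. p \<in> P}. ln (real p) / real p)"
      using \<open>u \<le> u ^ B\<close> u0 by (intro sum.cong) auto
    also have "\<dots> = ?S u + (\<Sum>p\<in>{p\<in>{u<..u^B}. p \<in> P}. ln (real p) / real p)"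
      by (intro sum.union_disjoint) auto
    finally have "?S (u ^ B) = ?S u + (\<Sum>p\<in>{p\<in>{u<..u^B}. p \<in> P}. ln (real p) / real p)" .
    then have "ln (real u) / 2 \<le> (\<Sum>p\<in>{p\<in>{u<..u^B}. p \<in> P}. ln (real p) / real p)"
      using 1 2 lnu by linarith
    also have "\<dots> \<le> (\<Sum>p\<in>{p\<in>{u<..u^B}. p \<in> P}. real B * ln (real u) * (1 / real p))"
    proof (intro sum_mono)
      fix p assume p: "p \<in> {p\<in>{u<..u^B}. p \<in> P}"
      then have "ln (real p) \<le> ln (real (u ^ B))" using u0 by (intro ln_mono) auto
      also have "\<dots> = real B * ln (real u)" using u0 by (simp add: ln_realpow)
      finally have "ln (real p) / real p \<le> real B * ln (real u) / real p" by (rule divide_right_mono) simp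
      then show "ln (real p) / real p \<le> real B * ln (real u) * (1 / real p)" by simp
    qed
    also have "\<dots> = real B * ln (real u) * (\<Sum>p\<in>{p\<in>{u<..u^B}. p \<in> P}. 1 / real p)"
      by (rule sum_distrib_left[symmetric])
    finally show "1 / (2 * real B) \<le> (\<Sum>p\<in>{p\<in>{u<..u^B}. p \<in> P}. 1 / real p)"
      by (rule final) (use B2 lnu in auto)
  qed (use B2 in auto)
qed

text \<open>Consecutive blocks with end points \<open>u ^ (B ^ j)\<close> each contribute
  \<open>1 / (2 * B)\<close>, so \<open>J\<close> of them suffice, with an exponent
  \<open>B ^ J\<close> that does not depend on \<open>u\<close>.\<close>

lemma reciprocal_sum_large:
  fixes P :: "nat set" and K :: real
  assumes P: "\<And>p. p \<in> P \<Longrightarrow> prime p" and "c > 0"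
    and lower: "\<And>x. x > 0 \<Longrightarrow> c * ln (real x) - C \<le> (\<Sum>p\<in>{p\<in>{1..x}. p \<in> P}. ln (real p) / real p)"
  obtains D U :: nat where "D > 0"
    "\<And>u. u \<ge> U \<Longrightarrow> K \<le> (\<Sum>p\<in>{p\<in>{u<..u^D}. p \<in> P}. 1 / real p)"
proof -
  obtain B U where B: "B \<ge> (2::nat)" "U \<ge> (2::nat)"
    "\<And>u. u \<ge> U \<Longrightarrow> 1 / (2 * real B) \<le> (\<Sum>p\<in>{p\<in>{u<..u^B}. p \<in> P}. 1 / real p)"
    using block_reciprocal_sum[OF P \<open>c > 0\<close> lower] by auto
  have J: "real J / (2 * real B) \<le> (\<Sum>p\<in>{p\<in>{u<..u^(B^J)}. p \<in> P}. 1 / real p)" if u: "u \<ge> U" for u J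
  proof (induction J)
    case 0
    show ?case by (simp add: sum_nonneg)
  next
    case (Suc J)
    define v w where "v = u ^ (B ^ J)" and "w = u ^ (B ^ Suc J)"
    have "u \<le> v" unfolding v_def using u B(1,2) by (intro self_le_power) auto
    have w: "w = v ^ B" unfolding v_def w_def power_Suc2 by (rule power_mult)
    have "v \<le> w" unfolding w using \<open>u \<le> v\<close> u B(1,2) by (intro self_le_power) auto
    have "(\<Sum>p\<in>{p\<in>{u<..w}. p \<in> P}. 1 / real p)
        = (\<Sum>p\<in>{p\<in>{u<..v}. p \<in> P} \<union> {p\<in>{v<..w}. p \<in> P}. 1 / real p)"
      using \<open>u \<le> v\<close> \<open>v \<le> w\<close> by (intro sum.cong) auto
    also have "\<dots> = (\<Sum>p\<in>{p\<in>{u<..v}. p \<in> P}. 1 / real p) + (\<Sum>p\<in>{p\<in>{v<..w}. p \<in> P}. 1 / real p)"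
      by (intro sum.union_disjoint) auto
    finally have "(\<Sum>p\<in>{p\<in>{u<..w}. p \<in> P}. 1 / real p)
        = (\<Sum>p\<in>{p\<in>{u<..v}. p \<in> P}. 1 / real p) + (\<Sum>p\<in>{p\<in>{v<..w}. p \<in> P}. 1 / real p)" .
    moreover have "1 / (2 * real B) \<le> (\<Sum>p\<in>{p\<in>{v<..w}. p \<in> P}. 1 / real p)"
      unfolding w using \<open>u \<le> v\<close> u by (intro B(3)) auto
    moreover have "real (Suc J) / (2 * real B) = real J / (2 * real B) + 1 / (2 * real B)"
      by (simp add: add_divide_distrib)
    ultimately show ?case using Suc unfolding v_def[symmetric] w_def[symmetric] by linarith
  qed
  define J where "J = nat \<lceil>2 * real B * K\<rceil>"
  have "K * (2 * real B) \<le> real J"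
    using real_nat_ceiling_ge[of "2 * real B * K"] by (simp add: J_def mult.commute)
  then have "K \<le> real J / (2 * real B)" using B(1) by (simp add: pos_le_divide_eq)
  then have large: "K \<le> (\<Sum>p\<in>{p\<in>{u<..u^(B^J)}. p \<in> P}. 1 / real p)" if "u \<ge> U" for u
    using J[OF that, of J] by (rule order.trans)
  show thesis
  proof (rule that)
    show "B ^ J > 0" using B(1) by simp
  qed (rule large)
qed

section \<open>Integers without prime divisors in a given set\<close>

lemma card_multiples: "card {n\<in>{1..x}. d dvd n} = x div d"
proof (cases "d = 0")
  case False
  have "{n\<in>{1..x}. d dvd n} = (\<lambda>k. d * k) ` {1..x div d}"
    using False by (auto simp: less_eq_div_iff_mult_less_eq mult.commute Suc_le_eq elim!: dvdE intro!: imageI)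
  moreover have "inj_on (\<lambda>k. d * k) {1..x div d}" using False by (auto simp: inj_on_def)
  ultimately show ?thesis by (simp add: card_image)
qed auto

lemma sum_of_bool_dvd: "(\<Sum>n=1..x. of_bool (d dvd n)) = real (x div d)"
proof -
  have "(\<Sum>n=1..x. of_bool (d dvd n)) = real (card {n\<in>{1..x}. d dvd n})"
    by (simp add: of_bool_def sum.If_cases Int_def)
  then show ?thesis by (simp only: card_multiples)
qed

lemma real_div_le: "real (x div d) \<le> real x / real d"
  using floor_divide_of_nat_eq[of x d, where ?'a = real] by linarith

lemma real_div_ge: "real x / real d - 1 \<le> real (x div d)"
  using floor_divide_of_nat_eq[of x d, where ?'a = real] by linarith

text \<open>The second moment argument of Turan: the number of prime divisors in \<open>T\<close> has variance
  at most its mean, up to a rounding error.\<close>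

lemma card_no_prime_divisor_le:
  assumes "finite T" and T: "\<And>p. p \<in> T \<Longrightarrow> prime p" and E: "E = (\<Sum>p\<in>T. 1 / real p)" "E > 0"
  shows "real (card {n\<in>{1..x}. \<forall>p\<in>T. \<not> p dvd n}) \<le> (real x + 2 * real (card T)) / E"
proof -
  define w where "w n = (\<Sum>p\<in>T. of_bool (p dvd n) :: real)" for n :: nat
  have sum_w: "(\<Sum>n=1..x. w n) = (\<Sum>p\<in>T. real (x div p))"
    unfolding w_def by (subst sum.swap) (simp only: sum_of_bool_dvd)
  have w_lower: "E * real x - real (card T) \<le> (\<Sum>n=1..x. w n)"
  proof -
    have "(\<Sum>p\<in>T. real x / real p - 1) \<le> (\<Sum>p\<in>T. real (x div p))"
      by (intro sum_mono real_div_ge)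
    then show ?thesis unfolding sum_w E(1) by (simp add: sum_subtractf sum_distrib_right)
  qed
  have w_sq: "(\<Sum>n=1..x. w n ^ 2) \<le> E^2 * real x + E * real x"
  proof -
    have "(\<Sum>n=1..x. w n ^ 2) = (\<Sum>n=1..x. \<Sum>p\<in>T. \<Sum>q\<in>T. of_bool (p dvd n \<and> q dvd n))"
      by (simp add: w_def power2_eq_square sum_product of_bool_conj)
    also have "\<dots> = (\<Sum>p\<in>T. \<Sum>q\<in>T. \<Sum>n=1..x. of_bool (p dvd n \<and> q dvd n))"
      by (subst sum.swap) (intro sum.cong HOL.refl sum.swap)
    \<comment> \<open>The term \<open>x / (p * q)\<close> is kept on the diagonal too, so that the
      double sum becomes exactly \<open>E^2 * x\<close>.\<close>
    also have "\<dots> \<le> (\<Sum>p\<in>T. \<Sum>q\<in>T. real x / (real p * real q) + (if p = q then real x / real p else 0))"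
    proof (intro sum_mono)
      fix p q assume pq: "p \<in> T" "q \<in> T"
      show "(\<Sum>n=1..x. of_bool (p dvd n \<and> q dvd n))
          \<le> real x / (real p * real q) + (if p = q then real x / real p else 0)"
      proof (cases "p = q")
        case True
        have "(\<Sum>n=1..x. of_bool (p dvd n \<and> q dvd n)) = real (x div p)"
          using True by (simp only: sum_of_bool_dvd conj_absorb)
        moreover have "0 \<le> real x / (real p * real q)" by simp
        ultimately show ?thesis unfolding if_P[OF True] using real_div_le[of x p] by linarith
      next
        case False
        have "coprime p q" using T pq False by (intro primes_coprime) auto
        then have "(p dvd n \<and> q dvd n) = (p * q dvd n)" for n
          by (meson divides_mult dvd_mult_left dvd_mult_right)
        then have "(\<Sum>n=1..x. of_bool (p dvd n \<and> q dvd n)) = real (x div (p * q))"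
          by (simp only: sum_of_bool_dvd)
        then show ?thesis using False real_div_le[of x "p * q"] by simp
      qed
    qed
    also have "\<dots> = (\<Sum>p\<in>T. \<Sum>q\<in>T. real x / (real p * real q)) + (\<Sum>p\<in>T. real x / real p)"
      using \<open>finite T\<close> by (simp add: sum.distrib)
    also have "(\<Sum>p\<in>T. \<Sum>q\<in>T. real x / (real p * real q)) = E^2 * real x"
      unfolding E(1) power2_eq_square sum_product unfolding sum_distrib_right by (intro sum.cong HOL.refl) simp
    also have "(\<Sum>p\<in>T. real x / real p) = E * real x"
      by (simp add: E sum_distrib_right)
    finally show ?thesis .
  qed
  let ?Z = "{n\<in>{1..x}. \<forall>p\<in>T. \<not> p dvd n}"
  \<comment> \<open>On \<open>?Z\<close> the count \<open>w\<close> is zero, so each element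
    contributes \<open>E^2\<close> to the variance.\<close>
  have "E^2 * real (card ?Z) = (\<Sum>n\<in>?Z. (w n - E)^2)"
    by (simp add: w_def)
  also have "\<dots> \<le> (\<Sum>n=1..x. (w n - E)^2)" by (intro sum_mono2) auto
  also have "\<dots> = (\<Sum>n=1..x. w n ^ 2) - 2 * E * (\<Sum>n=1..x. w n) + E^2 * real x"
    by (simp add: power2_diff sum.distrib sum_subtractf sum_distrib_left algebra_simps)
  also have "\<dots> \<le> (E^2 * real x + E * real x) - 2 * E * (E * real x - real (card T)) + E^2 * real x"
    using w_sq w_lower \<open>E > 0\<close> by (intro add_mono diff_mono mult_left_mono) auto
  also have "\<dots> = E * (real x + 2 * real (card T))" by (simp add: algebra_simps power2_eq_square)
  finally have "E * real (card ?Z) \<le> real x + 2 * real (card T)"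
    using \<open>E > 0\<close> by (simp add: power2_eq_square mult.assoc)
  then show ?thesis using \<open>E > 0\<close> by (simp add: field_simps)
qed

section \<open>Counting the exceptional integers\<close>

lemma sum_inverse_squares_le: "u > 0 \<Longrightarrow> (\<Sum>m\<in>{u<..x}. 1 / real m ^ 2) \<le> 1 / real u"
proof -
  assume u: "u > 0"
  have "(\<Sum>m\<in>{u<..x}. 1 / real m ^ 2) \<le> 1 / real u - 1 / real x" if "u \<le> x"
    using that
  proof (induction x rule: dec_induct)
    case (step n)
    have "{u<..Suc n} = insert (Suc n) {u<..n}" using step by auto
    moreover have "1 / real (Suc n) ^ 2 \<le> 1 / real n - 1 / real (Suc n)"
    proof -
      have n: "real n > 0" using u step by simp
      have "1 / real (Suc n) ^ 2 \<le> 1 / (real n * real (Suc n))"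
        using n by (intro divide_left_mono) (auto simp: power2_eq_square)
      also have "\<dots> = 1 / real n - 1 / real (Suc n)" using n by (simp add: field_simps)
      finally show ?thesis .
    qed
    ultimately show ?case using step by simp
  qed auto
  then show ?thesis by (cases "u \<le> x") (auto intro: order.trans)
qed

text \<open>The second alternative is that \<open>n\<close> has a divisor \<open>d > 1\<close>, necessarily coprime to \<open>p\<close>, with
  \<open>d mod p = 1\<close>.\<close>

definition exceptional :: "nat \<Rightarrow> nat \<Rightarrow> bool" where
  "exceptional p n \<longleftrightarrow> p ^ 2 dvd n \<or> (\<exists>j>0. p * (1 + j * p) dvd n)"

text \<open>A union bound over all integers \<open>p > u\<close>: multiples of \<open>p^2\<close>
  number at most \<open>x / p^2\<close>, and those of \<open>p * (1 + j * p)\<close> at most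
  \<open>x / (p^2 * j)\<close>. The sum over \<open>j\<close> gives the logarithm, the sum over
  \<open>p\<close> the factor \<open>1 / u\<close>.\<close>

lemma card_exceptional_le:
  assumes "u > 0"
  shows "real (card {n\<in>{1..x}. \<exists>p>u. exceptional p n}) \<le> real x * (2 + ln (real (max 1 x))) / real u"
proof -
  let ?A = "\<lambda>p. {n\<in>{1..x}. p ^ 2 dvd n}" and ?B = "\<lambda>p j. {n\<in>{1..x}. p * (1 + j * p) dvd n}"
  have sub: "{n\<in>{1..x}. \<exists>p>u. exceptional p n} \<subseteq> (\<Union>p\<in>{u<..x}. ?A p \<union> (\<Union>j\<in>{1..x}. ?B p j))"
  proof
    fix n assume "n \<in> {n\<in>{1..x}. \<exists>p>u. exceptional p n}"
    then obtain p where n: "n \<in> {1..x}" and p: "p > u" "exceptional p n" by auto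
    from p(2) show "n \<in> (\<Union>p\<in>{u<..x}. ?A p \<union> (\<Union>j\<in>{1..x}. ?B p j))"
      unfolding exceptional_def
    proof (elim disjE exE conjE)
      assume d: "p ^ 2 dvd n"
      then have "p ^ 2 \<le> n" using n by (intro dvd_imp_le) auto
      then have "p \<le> x" using n le_of_mult_le[of p p x] p by (auto simp: power2_eq_square)
      then show ?thesis using d n p by auto
    next
      fix j assume j: "j > 0" "p * (1 + j * p) dvd n"
      then have le: "p * (1 + j * p) \<le> x" using n by (auto dest!: dvd_imp_le)
      have "p \<le> x" using le le_of_mult_le[of "1 + j * p" p x] by simp
      moreover have "1 + j * p \<le> x" using le le_of_mult_le[of p "1 + j * p" x] p by (simp add: mult.commute)
      then have "j \<le> x" using le_of_mult_le[of p j x] p by simp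
      ultimately have "n \<in> ?B p j" "j \<in> {1..x}" "p \<in> {u<..x}" using j n p by auto
      then show ?thesis by blast
    qed
  qed
  have A: "real (card (?A p)) \<le> real x * (1 / real p ^ 2)" for p
    using real_div_le[of x "p ^ 2"] by (simp only: card_multiples) simp
  have B: "real (card (?B p j)) \<le> real x * (1 / real p ^ 2) * (1 / real j)" if "p > u" "j \<ge> 1" for p j
  proof -
    have "real (card (?B p j)) \<le> real x / real (p * (1 + j * p))"
      using real_div_le[of x "p * (1 + j * p)"] by (simp only: card_multiples)
    also have "\<dots> \<le> real x / (real p ^ 2 * real j)"
    proof (rule divide_left_mono)
      have "p ^ 2 * j \<le> p * (1 + j * p)" by (simp add: power2_eq_square algebra_simps)
      then show "real p ^ 2 * real j \<le> real (p * (1 + j * p))" by (metis of_nat_le_iff of_nat_mult of_nat_power)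
      show "0 < real (p * (1 + j * p)) * (real p ^ 2 * real j)"
        using that assms by (intro mult_pos_pos) (simp_all del: of_nat_mult of_nat_add)
    qed simp
    finally show ?thesis by simp
  qed
  have "card {n\<in>{1..x}. \<exists>p>u. exceptional p n} \<le> card (\<Union>p\<in>{u<..x}. ?A p \<union> (\<Union>j\<in>{1..x}. ?B p j))"
    using sub by (intro card_mono) auto
  also have "\<dots> \<le> (\<Sum>p\<in>{u<..x}. card (?A p \<union> (\<Union>j\<in>{1..x}. ?B p j)))"
    by (intro card_UN_le) auto
  also have "\<dots> \<le> (\<Sum>p\<in>{u<..x}. card (?A p) + (\<Sum>j=1..x. card (?B p j)))"
  proof (intro sum_mono)
    fix p
    have "card (?A p \<union> (\<Union>j\<in>{1..x}. ?B p j)) \<le> card (?A p) + card (\<Union>j\<in>{1..x}. ?B p j)"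
      by (rule card_Un_le)
    also have "card (\<Union>j\<in>{1..x}. ?B p j) \<le> (\<Sum>j=1..x. card (?B p j))"
      by (intro card_UN_le) auto
    finally show "card (?A p \<union> (\<Union>j\<in>{1..x}. ?B p j)) \<le> card (?A p) + (\<Sum>j=1..x. card (?B p j))"
      by simp
  qed
  finally have "real (card {n\<in>{1..x}. \<exists>p>u. exceptional p n})
      \<le> real (\<Sum>p\<in>{u<..x}. card (?A p) + (\<Sum>j=1..x. card (?B p j)))"
    by (simp only: of_nat_le_iff)
  also have "\<dots> = (\<Sum>p\<in>{u<..x}. real (card (?A p)) + (\<Sum>j=1..x. real (card (?B p j))))"
    by (simp only: of_nat_sum of_nat_add)
  also have "\<dots> \<le> (\<Sum>p\<in>{u<..x}. real x * (1 / real p ^ 2) + (\<Sum>j=1..x. real x * (1 / real p ^ 2) * (1 / real j)))"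
    by (intro sum_mono add_mono A B) auto
  also have "\<dots> = (\<Sum>p\<in>{u<..x}. 1 / real p ^ 2) * (real x * (1 + (\<Sum>j=1..x. 1 / real j)))"
    unfolding sum_distrib_right by (intro sum.cong HOL.refl) (simp only: sum_distrib_left[symmetric], simp add: algebra_simps)
  also have "\<dots> \<le> (1 / real u) * (real x * (1 + (1 + ln (real (max 1 x)))))"
    using sum_inverse_squares_le[OF assms, of x] harmonic_le_ln[of x] assms
    by (intro mult_mono mult_left_mono add_left_mono) (auto intro!: add_nonneg_nonneg sum_nonneg mult_nonneg_nonneg)
  finally show ?thesis by (simp add: field_simps)
qed

section \<open>Normal Sylow subgroups of prime order\<close>

lemma (in group) inv_cancel_left:
  assumes "x \<in> carrier G" "y \<in> carrier G"
  shows "inv x \<otimes> (x \<otimes> y) = y" "x \<otimes> (inv x \<otimes> y) = y"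
  using assms by (simp_all add: m_assoc[symmetric])

text \<open>The order of \<open>q0\<close> divides the prime \<open>p\<close> and is not 1, so it is
  \<open>p\<close>. This provides logarithms to the base \<open>q0\<close> on \<open>Q\<close>,
  unique modulo \<open>p\<close>.\<close>

lemma (in group) prime_card_subgroup_powers:
  assumes Q: "subgroup Q G" "card Q = p" "prime p" and q0: "q0 \<in> Q" "q0 \<noteq> \<one>"
  shows "\<And>q. q \<in> Q \<Longrightarrow> \<exists>n::nat. q = q0 [^] n"
    and "\<And>m n :: nat. q0 [^] m = q0 [^] n \<Longrightarrow> [m = n] (mod p)"
proof -
  let ?H = "G\<lparr>carrier := Q\<rparr>"
  interpret H: group ?H using Q(1) by (rule subgroup_imp_group)
  have fin: "finite (carrier ?H)"
    using card_ge_0_finite[of Q] Q prime_gt_0_nat by simp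
  have pow: "x [^]\<^bsub>?H\<^esub> n = x [^] n" for x and n :: nat
    by (simp add: nat_pow_def)
  have "H.ord q0 dvd p"
    using H.ord_dvd_group_order[of q0] q0 Q by (simp add: order_def)
  moreover have "H.ord q0 \<noteq> 1" using H.ord_eq_1[of q0] q0 by simp
  moreover have "\<forall>m. m dvd p \<longrightarrow> m = 1 \<or> m = p" using Q(3) unfolding prime_nat_iff by blast
  ultimately have ord: "H.ord q0 = p" by blast
  have inj: "inj_on (\<lambda>n. q0 [^] n) {0..p - 1}"
    using H.ord_inj[of q0] q0 by (simp add: ord pow)
  have "(\<lambda>n. q0 [^] n) ` {0..p - 1} \<subseteq> Q"
    using H.nat_pow_closed[of q0] q0 by (auto simp: pow)
  then have "(\<lambda>n. q0 [^] n) ` {0..p - 1} = Q"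
    using inj fin Q prime_gt_0_nat[of p] by (intro card_subset_eq) (auto simp: card_image)
  then show "\<exists>n::nat. q = q0 [^] n" if "q \<in> Q" for q using that by blast
  have mod: "q0 [^] n = q0 [^] (n mod p)" for n :: nat
  proof -
    have q0c: "q0 \<in> carrier G" using subgroup.mem_carrier[OF Q(1) q0(1)] .
    have "q0 [^] p = \<one>" using H.pow_ord_eq_1[of q0] q0 by (simp add: ord pow)
    then have "q0 [^] (p * (n div p)) = \<one>" using q0c by (simp add: nat_pow_pow[symmetric])
    moreover have "q0 [^] (p * (n div p)) \<otimes> q0 [^] (n mod p) = q0 [^] (p * (n div p) + n mod p)"
      using q0c by (rule nat_pow_mult)
    ultimately show ?thesis using q0c by simp
  qed
  show "[m = n] (mod p)" if "q0 [^] m = q0 [^] n" for m n :: nat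
  proof -
    have "q0 [^] (m mod p) = q0 [^] (n mod p)" using that mod[of m] mod[of n] by simp
    moreover have "k mod p \<le> p - 1" for k
      using mod_less_divisor[of p k] prime_gt_0_nat[OF Q(3)] by linarith
    ultimately show ?thesis using inj_onD[OF inj, of "m mod p" "n mod p"] by (simp add: cong_def)
  qed
qed

lemma (in group) conj_pow:
  assumes "g \<in> carrier G" "x \<in> carrier G"
  shows "g \<otimes> x [^] (n::nat) \<otimes> inv g = (g \<otimes> x \<otimes> inv g) [^] n"
proof (induction n)
  case (Suc n)
  have "g \<otimes> (x [^] n \<otimes> x) \<otimes> inv g = (g \<otimes> x [^] n \<otimes> inv g) \<otimes> (g \<otimes> x \<otimes> inv g)"
    using assms by (simp add: m_assoc inv_cancel_left)
  then show ?case using Suc by simp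
qed (use assms in simp)

lemma (in group) conj_mult:
  assumes "g \<in> carrier G" "h \<in> carrier G" "x \<in> carrier G"
  shows "(g \<otimes> h) \<otimes> x \<otimes> inv (g \<otimes> h) = g \<otimes> (h \<otimes> x \<otimes> inv h) \<otimes> inv g"
  using assms by (simp add: m_assoc inv_mult_group)

text \<open>A form of Sylow's third theorem: \<open>1 + j * p\<close> is the index of the normalizer, and the
  elements outside the normalizer fall into double cosets of \<open>Q\<close> of size \<open>p\<^sup>2\<close>.\<close>

lemma (in group) prime_subgroup_conj_closed:
  assumes fin: "finite (carrier G)" and Q: "subgroup Q G" "card Q = p" "prime p"
    and sq: "\<not> p ^ 2 dvd order G" and div: "\<And>j. j > 0 \<Longrightarrow> \<not> p * (1 + j * p) dvd order G"
    and "g \<in> carrier G" "q \<in> Q"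
  shows "g \<otimes> q \<otimes> inv g \<in> Q"
proof -
  have Qc: "x \<in> carrier G" if "x \<in> Q" for x using subgroup.mem_carrier[OF Q(1) that] .
  have Qm: "x \<otimes> y \<in> Q" if "x \<in> Q" "y \<in> Q" for x y using subgroup.m_closed[OF Q(1) that] .
  have Qi: "inv x \<in> Q" if "x \<in> Q" for x using subgroup.m_inv_closed[OF Q(1) that] .
  have Q1: "\<one> \<in> Q" using subgroup.one_closed[OF Q(1)] .
  have Qf: "finite Q" using card_ge_0_finite[of Q] Q prime_gt_0_nat by simp
  \<comment> \<open>The normalizer of \<open>Q\<close>: since \<open>Q\<close> is finite, mapping
    \<open>Q\<close> into itself by conjugation already means mapping it onto itself.\<close>
  define N where "N = {g \<in> carrier G. \<forall>q\<in>Q. g \<otimes> q \<otimes> inv g \<in> Q}"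
  have NI: "inv g \<in> N" if g: "g \<in> N" for g
  proof -
    have gc: "g \<in> carrier G" using g by (simp add: N_def)
    have "inj_on (\<lambda>q. g \<otimes> q \<otimes> inv g) Q"
      using gc Qc by (intro inj_onI) simp
    moreover have "(\<lambda>q. g \<otimes> q \<otimes> inv g) ` Q \<subseteq> Q" using g by (auto simp: N_def)
    ultimately have surj: "(\<lambda>q. g \<otimes> q \<otimes> inv g) ` Q = Q" using Qf by (intro endo_inj_surj)
    have "inv g \<otimes> q \<otimes> inv (inv g) \<in> Q" if q: "q \<in> Q" for q
    proof -
      have "q \<in> (\<lambda>q. g \<otimes> q \<otimes> inv g) ` Q" using surj q by simp
      then obtain x where x: "x \<in> Q" "q = g \<otimes> x \<otimes> inv g" by blast
      then have "inv g \<otimes> q \<otimes> inv (inv g) = x"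
        using gc Qc[of x] by (simp add: m_assoc inv_cancel_left)
      then show ?thesis using x by simp
    qed
    then show ?thesis using gc by (simp add: N_def)
  qed
  have NM: "g \<otimes> h \<in> N" if "g \<in> N" "h \<in> N" for g h
    using that Qc unfolding N_def by (auto simp: conj_mult)
  have QN: "Q \<subseteq> N" unfolding N_def using Qc Qm Qi by auto
  have N: "subgroup N G"
    using NI NM QN Q1 by (intro subgroupI) (auto simp: N_def)
  have Nc: "N \<subseteq> carrier G" by (auto simp: N_def)
  \<comment> \<open>The double coset of \<open>g\<close> with respect to \<open>Q\<close> on both
    sides.\<close>
  define D where "D g = (\<lambda>(a,b). a \<otimes> g \<otimes> b) ` (Q \<times> Q)" for g
  have D_self: "g \<in> D g" if "g \<in> carrier G" for g
    unfolding D_def using that Q1 by (intro image_eqI[of _ _ "(\<one>,\<one>)"]) auto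
  have D_sub: "D h \<subseteq> D g" if gc: "g \<in> carrier G" and "h \<in> D g" for g h
  proof
    fix x assume "x \<in> D h"
    obtain a b where ab: "a \<in> Q" "b \<in> Q" "h = a \<otimes> g \<otimes> b" using \<open>h \<in> D g\<close> by (auto simp: D_def)
    obtain c d where cd: "c \<in> Q" "d \<in> Q" "x = c \<otimes> h \<otimes> d" using \<open>x \<in> D h\<close> by (auto simp: D_def)
    have "x = (c \<otimes> a) \<otimes> g \<otimes> (b \<otimes> d)"
      using ab cd gc Qc by (simp add: m_assoc)
    then show "x \<in> D g" unfolding D_def using ab cd Qm by (intro image_eqI[of _ _ "(c \<otimes> a, b \<otimes> d)"]) auto
  qed
  have D_sym: "g \<in> D h" if gc: "g \<in> carrier G" and "h \<in> D g" for g h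
  proof -
    obtain a b where ab: "a \<in> Q" "b \<in> Q" "h = a \<otimes> g \<otimes> b" using \<open>h \<in> D g\<close> by (auto simp: D_def)
    have "g = inv a \<otimes> h \<otimes> inv b"
      using ab gc Qc by (simp add: m_assoc inv_cancel_left)
    then show ?thesis unfolding D_def using ab Qi by (intro image_eqI[of _ _ "(inv a, inv b)"]) auto
  qed
  have D_c: "D g \<subseteq> carrier G" if "g \<in> carrier G" for g
    using that Qc by (auto simp: D_def)
  have D_eq: "D g = D h" if g: "g \<in> carrier G" and h: "h \<in> carrier G" and "D g \<inter> D h \<noteq> {}" for g h
  proof -
    obtain x where x: "x \<in> D g" "x \<in> D h" using \<open>D g \<inter> D h \<noteq> {}\<close> by blast
    have xc: "x \<in> carrier G" using x(1) D_c[OF g] by blast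
    have "D g = D x" using D_sub[OF g x(1)] D_sub[OF xc D_sym[OF g x(1)]] by simp
    moreover have "D h = D x" using D_sub[OF h x(2)] D_sub[OF xc D_sym[OF h x(2)]] by simp
    ultimately show ?thesis by simp
  qed
  let ?C = "D ` (carrier G - N)"
  have D_N: "D g \<subseteq> carrier G - N" if g: "g \<in> carrier G - N" for g
  proof
    fix x assume x: "x \<in> D g"
    have "x \<notin> N"
    proof
      assume "x \<in> N"
      have "g \<in> D x" using D_sym x g by blast
      then obtain a b where "a \<in> Q" "b \<in> Q" "g = a \<otimes> x \<otimes> b" by (auto simp: D_def)
      then have "g \<in> N" using NM QN \<open>x \<in> N\<close> by blast
      then show False using g by blast
    qed
    then show "x \<in> carrier G - N" using D_c g x by blast
  qed
  have card_D: "card (D g) = p ^ 2" if g: "g \<in> carrier G - N" for g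
  proof -
    have gc: "g \<in> carrier G" using g by simp
    have "inj_on (\<lambda>(a,b). a \<otimes> g \<otimes> b) (Q \<times> Q)"
    proof (rule inj_onI, clarify)
      fix a b a' b' assume *: "a \<in> Q" "b \<in> Q" "a' \<in> Q" "b' \<in> Q" "a \<otimes> g \<otimes> b = a' \<otimes> g \<otimes> b'"
      note c = Qc[OF *(1)] Qc[OF *(2)] Qc[OF *(3)] Qc[OF *(4)] gc
      define d where "d = b' \<otimes> inv b"
      have d: "d \<in> Q" using * Qm Qi by (simp add: d_def)
      have "a \<otimes> g = a' \<otimes> g \<otimes> b' \<otimes> inv b"
        using *(5) c by (metis inv_solve_right m_closed)
      then have "inv a' \<otimes> a \<otimes> g = g \<otimes> d"
        using c by (simp add: d_def m_assoc inv_cancel_left)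
      then have "g \<otimes> d \<otimes> inv g = inv a' \<otimes> a"
        using c d Qc by (metis inv_closed inv_solve_right m_closed)
      then have gd: "g \<otimes> d \<otimes> inv g \<in> Q" using * Qm Qi by simp
      \<comment> \<open>A nontrivial \<open>d\<close> would generate \<open>Q\<close>, and as its
        conjugate by \<open>g\<close> lies in \<open>Q\<close>, the element \<open>g\<close> would
        belong to \<open>N\<close>.\<close>
      have "d = \<one>"
      proof (rule ccontr)
        assume "d \<noteq> \<one>"
        have pow: "x [^] (n::nat) \<in> Q" if "x \<in> Q" for x n
          using that Q1 Qm by (induction n) auto
        have "g \<otimes> x \<otimes> inv g \<in> Q" if x: "x \<in> Q" for x
        proof -
          obtain n :: nat where "x = d [^] n"
            using prime_card_subgroup_powers(1)[OF Q d \<open>d \<noteq> \<one>\<close> x] by blast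
          then show ?thesis using conj_pow[OF gc Qc[OF d]] pow[OF gd] by simp
        qed
        then show False using g gc by (auto simp: N_def)
      qed
      then have bb: "b = b'" using c by (metis d_def inv_equality inv_inv inv_closed inv_comm)
      then have "a = a'" using *(5) c by simp
      with bb show "a = a' \<and> b = b'" by simp
    qed
    then show ?thesis unfolding D_def using Q by (simp add: card_image card_cartesian_product power2_eq_square)
  qed
  have UC: "\<Union>?C = carrier G - N" using D_N D_self by blast
  have "p ^ 2 * card ?C = card (\<Union>?C)"
  proof (rule card_partition)
    show "finite ?C" "finite (\<Union>?C)" unfolding UC using fin by auto
    show "card c = p ^ 2" if "c \<in> ?C" for c using that card_D by auto
    show "c \<inter> d = {}" if "c \<in> ?C" "d \<in> ?C" "c \<noteq> d" for c d using that D_eq by blast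
  qed
  also have "\<dots> = order G - card N"
    unfolding UC order_def using fin Nc by (intro card_Diff_subset) (auto intro: finite_subset)
  finally have 1: "p ^ 2 * card ?C = order G - card N" .
  obtain i where i: "order G = i * card N"
    using lagrange[OF N] by (metis dvd_def)
  have "card N \<le> order G" unfolding order_def using Nc fin by (rule card_mono[rotated])
  with 1 have 2: "order G = card N + p ^ 2 * card ?C" by simp
  have "p dvd order G" using lagrange[OF Q(1)] Q(2) by (metis dvd_triv_right)
  then have "p dvd card N" unfolding 2 by (simp add: dvd_add_left_iff power2_eq_square)
  then obtain n where n: "card N = p * n" by blast
  have pn: "\<not> p dvd n"
  proof
    assume "p dvd n"
    then have "p ^ 2 dvd order G" unfolding i n by (auto simp: power2_eq_square)
    then show False using sq by blast
  qed
  have "i > 0" using i fin order_gt_0_iff_finite by (metis gr0I mult_0 less_irrefl)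
  \<comment> \<open>Comparing Lagrange's formula with the count by double cosets shows that the
    index \<open>i\<close> is 1 modulo \<open>p\<close>, the form excluded by the hypothesis unless
    \<open>i = 1\<close>.\<close>
  have "i * (p * n) = p * n + p ^ 2 * card ?C" using i 2 n by simp
  then have "p * (i * n) = p * (n + p * card ?C)" by (simp add: power2_eq_square algebra_simps)
  then have "i * n = n + p * card ?C" using prime_gt_0_nat[OF Q(3)] by simp
  then have "(i - 1) * n = p * card ?C" by (simp add: diff_mult_distrib)
  then have "p dvd (i - 1) * n" by simp
  then have "p dvd i - 1" using pn Q(3) prime_dvd_mult_iff by blast
  then obtain j where j: "i = 1 + j * p" using \<open>i > 0\<close> by (metis Suc_diff_1 dvd_def mult.commute plus_1_eq_Suc)
  have "p * (1 + j * p) dvd order G" unfolding i n j[symmetric] by (simp add: mult.left_commute)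
  then have "j = 0" using div by blast
  then have "card N = order G" using i j by simp
  then have "N = carrier G" using Nc fin unfolding order_def by (intro card_subset_eq)
  then show ?thesis using assms(7,8) by (auto simp: N_def)
qed

text \<open>The transfer into the normal subgroup \<open>Q\<close>, twisted by the conjugation action: in additive
  notation \<open>a\<close> is the action on \<open>Q\<close> and \<open>\<delta>\<close> a crossed homomorphism whose restriction to \<open>Q\<close> is
  multiplication by the index of \<open>Q\<close>.\<close>

lemma (in group) crossed_homomorphism:
  assumes fin: "finite (carrier G)" and Q: "Q \<lhd> G" "card Q = p" "prime p"
    and q0: "q0 \<in> Q" "q0 \<noteq> \<one>"
  obtains a \<delta> :: "'a \<Rightarrow> nat"
  where "\<And>g h. g \<in> carrier G \<Longrightarrow> h \<in> carrier G \<Longrightarrow> [a (g \<otimes> h) = a g * a h] (mod p)"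
    and "\<And>g h. g \<in> carrier G \<Longrightarrow> h \<in> carrier G \<Longrightarrow> [\<delta> (g \<otimes> h) = \<delta> g + a g * \<delta> h] (mod p)"
    and "[a q0 = 1] (mod p)" and "[\<delta> q0 = card (rcosets Q)] (mod p)"
proof -
  interpret Q: normal Q G by (rule Q(1))
  have sub: "subgroup Q G" by (rule Q.subgroup_axioms)
  have Qc: "x \<in> carrier G" if "x \<in> Q" for x using that by (rule Q.mem_carrier)
  have q0c: "q0 \<in> carrier G" using q0 Qc by blast
  \<comment> \<open>The logarithm to the base \<open>q0\<close>, which identifies \<open>Q\<close>
    with the integers modulo \<open>p\<close>.\<close>
  define E where "E q = (SOME n::nat. q = q0 [^] n)" for q
  have E: "q0 [^] E q = q" if "q \<in> Q" for q
    unfolding E_def using someI_ex[OF prime_card_subgroup_powers(1)[OF sub Q(2,3) q0 that]] by simp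
  have E_cong: "[E q = n] (mod p)" if "q \<in> Q" "q = q0 [^] n" for q n
    using prime_card_subgroup_powers(2)[OF sub Q(2,3) q0, of "E q" n] E that by simp
  have conjQ: "g \<otimes> q \<otimes> inv g \<in> Q" if "g \<in> carrier G" "q \<in> Q" for g q
    using that by (rule Q.inv_op_closed2)
  define a where "a g = E (g \<otimes> q0 \<otimes> inv g)" for g
  have conj_eq: "g \<otimes> q \<otimes> inv g = q0 [^] (a g * E q)" if "g \<in> carrier G" "q \<in> Q" for g q
  proof -
    have "g \<otimes> q \<otimes> inv g = g \<otimes> q0 [^] E q \<otimes> inv g" using E that by simp
    also have "\<dots> = (g \<otimes> q0 \<otimes> inv g) [^] E q" using that q0c by (intro conj_pow)
    also have "\<dots> = (q0 [^] a g) [^] E q" unfolding a_def using E conjQ that q0 by simp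
    also have "\<dots> = q0 [^] (a g * E q)" using q0c by (simp add: nat_pow_pow)
    finally show ?thesis .
  qed
  define t where "t u = (SOME g. g \<in> u)" for u :: "'a set"
  have t: "t u \<in> carrier G" "Q #> t u = u" if uR: "u \<in> rcosets Q" for u
  proof -
    obtain g where g: "g \<in> carrier G" "u = Q #> g" using uR by (auto simp: RCOSETS_def)
    then have "g \<in> u" using rcos_self sub by blast
    then have tu: "t u \<in> u" unfolding t_def by (rule someI)
    then show "t u \<in> carrier G" using g r_coset_subset_G Q.subset by blast
    show "Q #> t u = u" using repr_independence tu g sub by blast
  qed
  \<comment> \<open>Left multiplication on the right cosets of \<open>Q\<close>; normality makes it
    independent of the representative \<open>t u\<close>.\<close>
  define act where "act g u = Q #> (g \<otimes> t u)" for g u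
  have act_in: "act g u \<in> rcosets Q" if "g \<in> carrier G" "u \<in> rcosets Q" for g u
    unfolding act_def RCOSETS_def using that t by blast
  have act_alt: "act g (Q #> x) = Q #> (g \<otimes> x)" if "g \<in> carrier G" "x \<in> carrier G" for g x
  proof -
    have u: "Q #> x \<in> rcosets Q" using that by (auto simp: RCOSETS_def)
    have "act g (Q #> x) = (Q #> g) <#> (Q #> t (Q #> x))"
      unfolding act_def using that t[OF u] by (intro Q.rcos_sum[symmetric])
    also have "\<dots> = (Q #> g) <#> (Q #> x)" using t[OF u] by simp
    also have "\<dots> = Q #> (g \<otimes> x)" using that by (intro Q.rcos_sum)
    finally show ?thesis .
  qed
  have act_mult: "act (g \<otimes> h) u = act g (act h u)" if "g \<in> carrier G" "h \<in> carrier G" "u \<in> rcosets Q" for g h u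
    using that t[OF that(3)] act_alt[of g "h \<otimes> t u"] by (simp add: act_def m_assoc)
  have act_one: "act \<one> u = u" if "u \<in> rcosets Q" for u
    using t[OF that] by (simp add: act_def)
  have act_bij: "bij_betw (act g) (rcosets Q) (rcosets Q)" if g: "g \<in> carrier G" for g
  proof (rule bij_betwI[where g = "act (inv g)"])
    show "act g \<in> rcosets Q \<rightarrow> rcosets Q" "act (inv g) \<in> rcosets Q \<rightarrow> rcosets Q"
      using g act_in by auto
    show "act (inv g) (act g u) = u" "act g (act (inv g) u) = u" if "u \<in> rcosets Q" for u
      using act_mult[of "inv g" g u] act_mult[of g "inv g" u] act_one that g by auto
  qed
  \<comment> \<open>The element of \<open>Q\<close> by which \<open>g \<otimes> t u\<close> deviates
    from the chosen representative of its coset.\<close>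
  define e where "e g u = g \<otimes> t u \<otimes> inv (t (act g u))" for g u
  have eQ: "e g u \<in> Q" if "g \<in> carrier G" "u \<in> rcosets Q" for g u
  proof -
    have "g \<otimes> t u \<in> Q #> t (act g u)"
      using that t[OF that(2)] t(2)[OF act_in[OF that]] rcos_self[OF _ sub, of "g \<otimes> t u"]
      by (simp add: act_def)
    then show ?thesis unfolding e_def
      using Q.rcos_module_imp t(1)[OF act_in[OF that]] is_group by blast
  qed
  have e_mult: "e (g \<otimes> h) u = (g \<otimes> e h u \<otimes> inv g) \<otimes> e g (act h u)"
    if "g \<in> carrier G" "h \<in> carrier G" "u \<in> rcosets Q" for g h u
  proof -
    have c: "t u \<in> carrier G" "t (act h u) \<in> carrier G" "t (act (g \<otimes> h) u) \<in> carrier G"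
      using that t act_in by auto
    show ?thesis
      using that c by (simp add: e_def act_mult[OF that, symmetric] m_assoc inv_cancel_left)
  qed
  have Ee: "[E (e (g \<otimes> h) u) = E (e g (act h u)) + a g * E (e h u)] (mod p)"
    if "g \<in> carrier G" "h \<in> carrier G" "u \<in> rcosets Q" for g h u
  proof (rule E_cong)
    show "e (g \<otimes> h) u \<in> Q" using that eQ by simp
    have "e (g \<otimes> h) u = q0 [^] (a g * E (e h u)) \<otimes> q0 [^] E (e g (act h u))"
      using that by (simp add: e_mult conj_eq eQ act_in E)
    then show "e (g \<otimes> h) u = q0 [^] (E (e g (act h u)) + a g * E (e h u))"
      using q0c by (simp add: nat_pow_mult add.commute)
  qed
  define \<delta> where "\<delta> g = (\<Sum>u\<in>rcosets Q. E (e g u))" for g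
  show thesis
  proof (rule that[of a \<delta>])
    fix g h assume gh: "g \<in> carrier G" "h \<in> carrier G"
    show "[a (g \<otimes> h) = a g * a h] (mod p)"
    proof -
      have "(g \<otimes> h) \<otimes> q0 \<otimes> inv (g \<otimes> h) = q0 [^] (a g * a h)"
        using conj_mult[OF gh q0c] conj_eq[OF gh(1) conjQ[OF gh(2) q0(1)]] by (simp add: a_def)
      then show ?thesis unfolding a_def[of "g \<otimes> h"] using conjQ[of "g \<otimes> h" q0] gh q0
        by (intro E_cong) auto
    qed
    have "[\<delta> (g \<otimes> h) = (\<Sum>u\<in>rcosets Q. E (e g (act h u)) + a g * E (e h u))] (mod p)"
      unfolding \<delta>_def using Ee gh by (intro cong_sum) auto
    \<comment> \<open>As \<open>act h\<close> permutes the cosets, the first summands add up to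
      \<open>\<delta> g\<close>.\<close>
    also have "(\<Sum>u\<in>rcosets Q. E (e g (act h u)) + a g * E (e h u)) = \<delta> g + a g * \<delta> h"
      unfolding sum.distrib sum_distrib_left[symmetric] \<delta>_def
      using sum.reindex_bij_betw[OF act_bij[OF gh(2)], of "\<lambda>u. E (e g u)"] by simp
    finally show "[\<delta> (g \<otimes> h) = \<delta> g + a g * \<delta> h] (mod p)" .
  next
    show "[a q0 = 1] (mod p)"
      unfolding a_def using q0 q0c by (intro E_cong) (simp_all add: m_assoc)
    \<comment> \<open>The element \<open>q0\<close> fixes every coset and deviates by itself, so
      each coset contributes 1.\<close>
    have "[E (e q0 u) = 1] (mod p)" if "u \<in> rcosets Q" for u
    proof (rule E_cong)
      have "act q0 u = u"
      proof -
        have "act q0 u = (Q #> q0) #> t u"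
          unfolding act_def using q0c t[OF that] Q.subset by (simp add: coset_mult_assoc)
        also have "Q #> q0 = Q" using q0 sub coset_join2 q0c by blast
        finally show ?thesis using t[OF that] by simp
      qed
      then show "e q0 u = q0 [^] (1::nat)"
        using q0c t[OF that] by (simp add: e_def m_assoc)
    qed (use that q0c eQ in auto)
    then have "[\<delta> q0 = (\<Sum>u\<in>rcosets Q. 1)] (mod p)"
      unfolding \<delta>_def by (intro cong_sum) auto
    then show "[\<delta> q0 = card (rcosets Q)] (mod p)" by simp
  qed
qed

section \<open>Affine actions modulo \<open>p\<close> and their fixed points\<close>

lemma cong_plus_minus_one:
  fixes a :: nat
  assumes "prime p" "N > 0" "[a ^ N = 1] (mod p)" "gcd N (p - 1) dvd 2"
  shows "[int a = 1] (mod int p) \<or> [int a = -1] (mod int p)"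
proof -
  have "coprime a p"
  proof (rule ccontr)
    assume "\<not> coprime a p"
    then have "p dvd a" using assms(1) prime_imp_coprime_nat coprime_commute by blast
    then have "p dvd a ^ N" using assms(2) by (simp add: dvd_power_le[of p a 1 N, simplified] dvd_trans[OF _ dvd_power])
    then have "p dvd 1" using assms(3) cong_dvd_iff by blast
    then show False using assms(1) by (simp add: not_prime_1)
  qed
  \<comment> \<open>The order of \<open>a\<close> modulo \<open>p\<close> divides both
    \<open>N\<close> and \<open>p - 1\<close>, hence 2, so \<open>a\<close> is a square root of 1
    modulo a prime.\<close>
  have "ord p a dvd N" using assms(3) by (simp only: ord_divides)
  moreover have "ord p a dvd p - 1"
    using order_divides_totient[of p a] \<open>coprime a p\<close> assms(1) by (simp add: totient_prime coprime_commute)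
  ultimately have "ord p a dvd 2" using assms(4) by (meson gcd_greatest dvd_trans)
  then have "[a ^ 2 = 1] (mod p)" by (simp only: ord_divides)
  then have "[int a ^ 2 = 1] (mod int p)" using cong_int_iff[of "a ^ 2" 1 p] by simp
  then have "int p dvd (int a - 1) * (int a + 1)"
    by (simp add: cong_iff_dvd_diff power2_eq_square algebra_simps)
  then show ?thesis
    using assms(1) prime_dvd_mult_iff[of "int p"] by (auto simp: cong_iff_dvd_diff)
qed

text \<open>The group acts by sending \<open>v\<close> to \<open>a g * v + \<delta> g\<close>. If
  \<open>g [^] N = \<one>\<close>, the linear part is 1 or -1. Linear part 1 gives a translation
  killed by \<open>N\<close>, which is prime to \<open>p\<close>, hence the identity; linear part -1
  gives the fixed point \<open>\<delta> g / 2\<close>.\<close>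

lemma (in group) crossed_homomorphism_fixed_points:
  fixes a \<delta> :: "'a \<Rightarrow> nat"
  assumes "prime p" "p > 2" and N: "N > 0" "gcd N (p - 1) dvd 2" "\<not> p dvd N"
    and a_mult: "\<And>g h. g \<in> carrier G \<Longrightarrow> h \<in> carrier G \<Longrightarrow> [a (g \<otimes> h) = a g * a h] (mod p)"
    and d_mult: "\<And>g h. g \<in> carrier G \<Longrightarrow> h \<in> carrier G \<Longrightarrow> [\<delta> (g \<otimes> h) = \<delta> g + a g * \<delta> h] (mod p)"
    and one: "[a \<one> = 1] (mod p)" "[\<delta> \<one> = 0] (mod p)"
    and x: "x \<in> carrier G" "x [^] N = \<one>" and y: "y \<in> carrier G" "y [^] N = \<one>"
    and xy: "(x \<otimes> y) [^] N = \<one>"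
  shows "\<exists>v. [int (a x) * v + int (\<delta> x) = v] (mod int p) \<and> [int (a y) * v + int (\<delta> y) = v] (mod int p)"
proof -
  have a_pow: "[a (g [^] n) = a g ^ n] (mod p)" if "g \<in> carrier G" for g and n :: nat
  proof (induction n)
    case (Suc n)
    have "[a (g [^] n \<otimes> g) = a (g [^] n) * a g] (mod p)" using that by (intro a_mult) auto
    also have "[a (g [^] n) * a g = a g ^ n * a g] (mod p)" by (intro cong_mult Suc cong_refl)
    finally show ?case by (simp add: mult.commute)
  qed (use one in simp)
  have d_pow: "[\<delta> (g [^] n) = n * \<delta> g] (mod p)" if "g \<in> carrier G" "[a g = 1] (mod p)" for g and n :: nat
  proof (induction n)
    case (Suc n)
    have "[a (g [^] n) = 1] (mod p)"
      using cong_trans[OF a_pow[OF that(1)] cong_pow[OF that(2)]] by simp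
    have "[\<delta> (g [^] n \<otimes> g) = \<delta> (g [^] n) + a (g [^] n) * \<delta> g] (mod p)" using that by (intro d_mult) auto
    also have "[\<delta> (g [^] n) + a (g [^] n) * \<delta> g = n * \<delta> g + 1 * \<delta> g] (mod p)"
      by (intro cong_add cong_mult Suc cong_refl \<open>[a (g [^] n) = 1] (mod p)\<close>)
    finally show ?case by (simp add: algebra_simps)
  qed (use one in simp)
  have sign: "[int (a g) = 1] (mod int p) \<or> [int (a g) = -1] (mod int p)"
    if "g \<in> carrier G" "g [^] N = \<one>" for g
  proof (rule cong_plus_minus_one[OF assms(1) N(1) _ N(2)])
    show "[a g ^ N = 1] (mod p)" using cong_trans[OF cong_sym[OF a_pow[OF that(1), of N]]] that one by simp
  qed
  have triv: "[int (\<delta> g) = 0] (mod int p)"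
    if "g \<in> carrier G" "g [^] N = \<one>" "[int (a g) = 1] (mod int p)" for g
  proof -
    have "[a g = 1] (mod p)" using that cong_int_iff[of "a g" 1 p] by simp
    then have "[N * \<delta> g = 0] (mod p)"
      using cong_trans[OF cong_sym[OF d_pow[OF that(1), of N]]] that one by simp
    then have "p dvd \<delta> g" using assms(1) N(3) by (simp add: cong_0_iff prime_dvd_mult_iff)
    then show ?thesis by (simp add: cong_0_iff)
  qed
  have fix1: "[int (a g) * v + int (\<delta> g) = v] (mod int p)"
    if "g \<in> carrier G" "g [^] N = \<one>" "[int (a g) = 1] (mod int p)" for g v
    using cong_add[OF cong_mult[OF that(3) cong_refl[of v]] triv[OF that]] by simp
  \<comment> \<open>The inverse of 2 modulo the odd prime \<open>p\<close>.\<close>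
  define half where "half = (int p + 1) div 2"
  have "odd p" using assms(1,2) prime_odd_nat by blast
  then have half: "2 * half = int p + 1" unfolding half_def by (intro dvd_mult_div_cancel) simp
  have fix2: "[int (a g) * v + int (\<delta> g) = v] (mod int p)"
    if "[int (a g) = -1] (mod int p)" "[v = half * int (\<delta> g)] (mod int p)" for g v
  proof -
    have "[int (a g) * v + int (\<delta> g) = - 1 * v + int (\<delta> g)] (mod int p)"
      by (intro cong_add cong_mult that cong_refl)
    moreover have "[- 1 * v + int (\<delta> g) = v] (mod int p)"
    proof -
      have "[2 * v = 2 * (half * int (\<delta> g))] (mod int p)" by (intro cong_mult that cong_refl)
      also have "2 * (half * int (\<delta> g)) = int (\<delta> g) + int p * int (\<delta> g)"
        using half by (metis distrib_right mult.assoc mult_1 add.commute)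
      also have "[int (\<delta> g) + int p * int (\<delta> g) = int (\<delta> g)] (mod int p)"
        by (simp add: cong_iff_dvd_diff)
      finally have "[2 * v - v = int (\<delta> g) - v] (mod int p)" by (intro cong_diff cong_refl)
      then show ?thesis by (simp add: cong_sym)
    qed
    ultimately show ?thesis by (rule cong_trans)
  qed
  consider "[int (a x) = 1] (mod int p)" | "[int (a y) = 1] (mod int p)"
    | "[int (a x) = -1] (mod int p)" "[int (a y) = -1] (mod int p)"
    using sign x y by blast
  then show ?thesis
  proof cases
    case 1
    have "\<exists>v. [int (a y) * v + int (\<delta> y) = v] (mod int p)"
      using sign[OF y] fix1[OF y] fix2[of y, OF _ cong_refl] by blast
    then show ?thesis using fix1[OF x 1] by blast
  next
    case 2
    have "\<exists>v. [int (a x) * v + int (\<delta> x) = v] (mod int p)"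
      using sign[OF x] fix1[OF x] fix2[of x, OF _ cong_refl] by blast
    then show ?thesis using fix1[OF y 2] by blast
  next
    case 3
    \<comment> \<open>The product has linear part 1 and so acts trivially, which forces
      \<open>\<delta> x\<close> and \<open>\<delta> y\<close> to agree; the two fixed points then
      coincide.\<close>
    have "[int (a (x \<otimes> y)) = int (a x) * int (a y)] (mod int p)"
      using a_mult[OF x(1) y(1)] cong_int_iff by (metis of_nat_mult)
    also have "[int (a x) * int (a y) = -1 * -1] (mod int p)" by (intro cong_mult 3)
    finally have "[int (\<delta> (x \<otimes> y)) = 0] (mod int p)" using x y xy by (intro triv) auto
    moreover have "[int (\<delta> (x \<otimes> y)) = int (\<delta> x) + int (a x) * int (\<delta> y)] (mod int p)"
      using d_mult[OF x(1) y(1)] cong_int_iff by (metis of_nat_mult of_nat_add)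
    moreover have "[int (\<delta> x) + int (a x) * int (\<delta> y) = int (\<delta> x) + -1 * int (\<delta> y)] (mod int p)"
      by (intro cong_add cong_mult 3 cong_refl)
    ultimately have "[int (\<delta> x) - int (\<delta> y) = 0] (mod int p)"
      by (metis cong_sym cong_trans add_uminus_conv_diff mult_minus1)
    then have "[int (\<delta> x) = int (\<delta> y)] (mod int p)" by (simp add: cong_iff_dvd_diff)
    then have "[half * int (\<delta> x) = half * int (\<delta> y)] (mod int p)" by (intro cong_mult cong_refl)
    then show ?thesis using fix2[OF 3(1) cong_refl] fix2[OF 3(2)] by blast
  qed
qed

text \<open>The stabilizer \<open>S\<close> of a common fixed point of \<open>x\<close> and
  \<open>y\<close> is all of \<open>G\<close>, so \<open>q0\<close> fixes that point. But
  \<open>q0\<close> acts as translation by the index of \<open>Q\<close>, which \<open>p\<close>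
  does not divide because \<open>p^2\<close> does not divide the group order.\<close>

lemma (in group) no_triangle_generators:
  assumes fin: "finite (carrier G)"
    and p: "prime p" "p > 2" "N > 0" "gcd N (p - 1) dvd 2" "\<not> p dvd N"
    and ord: "p dvd order G" "\<not> p ^ 2 dvd order G" "\<And>j. j > 0 \<Longrightarrow> \<not> p * (1 + j * p) dvd order G"
    and x: "x \<in> carrier G" "x [^] N = \<one>" and y: "y \<in> carrier G" "y [^] N = \<one>"
    and xy: "(x \<otimes> y) [^] N = \<one>"
    and gen: "\<And>S. subgroup S G \<Longrightarrow> x \<in> S \<Longrightarrow> y \<in> S \<Longrightarrow> S = carrier G"
  shows False
proof -
  obtain m where m: "order G = p ^ 1 * m" using ord(1) by auto
  obtain Q where Q: "subgroup Q G" "card Q = p"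
    using sylow_thm[OF p(1) is_group m fin] by auto
  have "Q \<lhd> G"
    using prime_subgroup_conj_closed[OF fin Q p(1) ord(2,3)] Q(1) by (auto simp: normal_inv_iff)
  obtain q0 where q0: "q0 \<in> Q" "q0 \<noteq> \<one>"
  proof (rule ccontr)
    assume "\<not> thesis"
    then have "Q \<subseteq> {\<one>}" using that by blast
    then have "card Q \<le> 1" using card_mono[of "{\<one>}" Q] by simp
    then show False using Q(2) p(2) by simp
  qed
  have q0c: "q0 \<in> carrier G" using subgroup.mem_carrier[OF Q(1) q0(1)] .
  obtain a \<delta> :: "'a \<Rightarrow> nat"
    where a_mult: "\<And>g h. g \<in> carrier G \<Longrightarrow> h \<in> carrier G \<Longrightarrow> [a (g \<otimes> h) = a g * a h] (mod p)"
    and d_mult: "\<And>g h. g \<in> carrier G \<Longrightarrow> h \<in> carrier G \<Longrightarrow> [\<delta> (g \<otimes> h) = \<delta> g + a g * \<delta> h] (mod p)"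
    and aq: "[a q0 = 1] (mod p)" and dq: "[\<delta> q0 = card (rcosets Q)] (mod p)"
    using crossed_homomorphism[OF fin \<open>Q \<lhd> G\<close> Q(2) p(1) q0] by metis
  \<comment> \<open>The values at the identity follow from the product rules applied to
    \<open>q0 \<otimes> \<one>\<close>, because \<open>a q0\<close> is 1 and can be
    cancelled.\<close>
  have a1: "[a \<one> = 1] (mod p)"
  proof -
    have "[a q0 * a \<one> = 1 * a \<one>] (mod p)" by (intro cong_mult aq cong_refl)
    moreover have "[a q0 = a q0 * a \<one>] (mod p)" using a_mult[OF q0c one_closed] q0c by simp
    ultimately show ?thesis using aq by (metis cong_sym cong_trans mult_1)
  qed
  have d1: "[\<delta> \<one> = 0] (mod p)"
  proof -
    have "[\<delta> q0 + 0 = \<delta> q0 + a q0 * \<delta> \<one>] (mod p)" using d_mult[OF q0c one_closed] q0c by simp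
    then have "[0 = a q0 * \<delta> \<one>] (mod p)" using cong_add_lcancel_nat by blast
    moreover have "[a q0 * \<delta> \<one> = 1 * \<delta> \<one>] (mod p)" by (intro cong_mult aq cong_refl)
    ultimately show ?thesis by (metis cong_sym cong_trans mult_1)
  qed
  obtain v where v: "[int (a x) * v + int (\<delta> x) = v] (mod int p)" "[int (a y) * v + int (\<delta> y) = v] (mod int p)"
    using crossed_homomorphism_fixed_points[OF p a_mult d_mult a1 d1 x y xy] by blast
  define S where "S = {g \<in> carrier G. [int (a g) * v + int (\<delta> g) = v] (mod int p)}"
  have comp: "[int (a (g \<otimes> h)) * v + int (\<delta> (g \<otimes> h)) = int (a g) * (int (a h) * v + int (\<delta> h)) + int (\<delta> g)] (mod int p)"
    if "g \<in> carrier G" "h \<in> carrier G" for g h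
  proof -
    have "[int (a (g \<otimes> h)) = int (a g) * int (a h)] (mod int p)"
      using a_mult[OF that] cong_int_iff by (metis of_nat_mult)
    moreover have "[int (\<delta> (g \<otimes> h)) = int (\<delta> g) + int (a g) * int (\<delta> h)] (mod int p)"
      using d_mult[OF that] cong_int_iff by (metis of_nat_mult of_nat_add)
    ultimately have "[int (a (g \<otimes> h)) * v + int (\<delta> (g \<otimes> h))
        = int (a g) * int (a h) * v + (int (\<delta> g) + int (a g) * int (\<delta> h))] (mod int p)"
      by (intro cong_add cong_mult cong_refl)
    then show ?thesis by (simp add: algebra_simps)
  qed
  have id: "[int (a \<one>) * w + int (\<delta> \<one>) = w] (mod int p)" for w
  proof -
    have "[int (a \<one>) * w + int (\<delta> \<one>) = 1 * w + 0] (mod int p)"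
      using a1 d1 cong_int_iff[of "a \<one>" 1 p] cong_int_iff[of "\<delta> \<one>" 0 p]
      by (intro cong_add cong_mult cong_refl) auto
    then show ?thesis by simp
  qed
  have fix_comp: "[int (a (g \<otimes> h)) * v + int (\<delta> (g \<otimes> h)) = int (a g) * v + int (\<delta> g)] (mod int p)"
    if "g \<in> carrier G" "h \<in> S" for g h
  proof (rule cong_trans[OF comp])
    show "[int (a g) * (int (a h) * v + int (\<delta> h)) + int (\<delta> g) = int (a g) * v + int (\<delta> g)] (mod int p)"
      using that by (intro cong_add cong_mult cong_refl) (auto simp: S_def)
  qed (use that in \<open>auto simp: S_def\<close>)
  have "subgroup S G"
  proof (rule subgroupI)
    show "S \<subseteq> carrier G" by (auto simp: S_def)
    show "S \<noteq> {}" using id[of v] by (auto simp: S_def)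
    show "inv g \<in> S" if "g \<in> S" for g
    proof -
      have "g \<in> carrier G" using that by (simp add: S_def)
      then have "[int (a (inv g)) * v + int (\<delta> (inv g)) = v] (mod int p)"
        using cong_trans[OF cong_sym[OF fix_comp[of "inv g" g]] ] that id[of v] by simp
      then show ?thesis using \<open>g \<in> carrier G\<close> by (simp add: S_def)
    qed
    show "g \<otimes> h \<in> S" if "g \<in> S" "h \<in> S" for g h
      using cong_trans[OF fix_comp[of g h]] that by (simp add: S_def)
  qed
  then have "S = carrier G" using x y v by (intro gen) (auto simp: S_def)
  then have "[int (a q0) * v + int (\<delta> q0) = v] (mod int p)" using q0c by (auto simp: S_def)
  moreover have "[int (a q0) * v + int (\<delta> q0) = 1 * v + int (card (rcosets Q))] (mod int p)"
    using aq dq cong_int_iff[of "a q0" 1 p] cong_int_iff[of "\<delta> q0" "card (rcosets Q)" p]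
    by (intro cong_add cong_mult cong_refl) auto
  ultimately have "[v = v + int (card (rcosets Q))] (mod int p)" by (metis cong_sym cong_trans mult_1)
  then have "int p dvd int (card (rcosets Q))" by (simp add: cong_iff_dvd_diff)
  then have "p dvd card (rcosets Q)" by simp
  moreover have "order G = card (rcosets Q) * p" using lagrange[OF Q(1)] Q(2) by simp
  ultimately show False using ord(2) by (auto simp: power2_eq_square)
qed

section \<open>Orders of finite quotients of triangle groups\<close>

text \<open>Otherwise the images of the generators would contradict
  \<open>no_triangle_generators\<close>, with \<open>N = r * s * t\<close> as a common multiple of
  the three exponents.\<close>

lemma good_prime_dvd_quotient_order:
  assumes "r > 0" "s > 0" "t > 0" and n: "n \<in> finite_quotient_orders (triangle_group r s t)"
    and p: "good_prime (r * s * t) p" "p dvd n"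
  shows "exceptional p n"
proof (rule ccontr)
  assume not_exc: "\<not> exceptional p n"
  define N where "N = r * s * t"
  define R where "R = triangle_relators r s t"
  obtain H :: "nat monoid" where H: "group H" "finite (carrier H)" "n = order H"
    and "epi (triangle_group r s t) H \<noteq> {}"
    using n by (auto simp: finite_quotient_orders_def)
  then obtain h where h: "h \<in> epi (presented_group R) H"
    by (auto simp: triangle_group_def R_def)
  interpret H: group H by (rule H(1))
  \<comment> \<open>The value of a word in the quotient \<open>H\<close>; it turns concatenation
    into products and relators into the identity.\<close>
  define W where "W w = h (word_class R w)" for w
  have hom: "h \<in> hom (presented_group R) H" and img: "h ` carrier (presented_group R) = carrier H"
    using h by (auto simp: epi_def)
  have wc: "word_class R w \<in> carrier (presented_group R)" for w
    by (simp add: presented_group_def)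
  have Wc: "W w \<in> carrier H" for w
    unfolding W_def using hom_in_carrier[OF hom wc] .
  have W_app: "W (u @ v) = W u \<otimes>\<^bsub>H\<^esub> W v" for u v
    unfolding W_def using hom_mult[OF hom wc wc, of u v] by (simp add: presented_group_mult)
  have W_eq: "W u = W v" if "word_eq R u v" for u v
    unfolding W_def using that word_class_eq_iff[of R u v] by simp
  have W_Nil: "W [] = \<one>\<^bsub>H\<^esub>"
    using W_app[of "[]" "[]"] Wc[of "[]"] by (simp add: H.l_cancel_one')
  have W_replicate: "W (replicate k l) = W [l] [^]\<^bsub>H\<^esub> k" for k l
  proof (induction k)
    case (Suc k)
    then show ?case
      using W_app[of "replicate k l" "[l]"] by (simp add: replicate_append_same)
  qed (simp add: W_Nil)
  have W_relator: "W q = \<one>\<^bsub>H\<^esub>" if "q \<in> R" for q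
    using W_eq[OF word_eq.relator[OF that, of "[]" "[]"]] by (simp add: W_Nil)
  define x y z where "x = W [(Gen_x, True)]" and "y = W [(Gen_y, True)]" and "z = W [(Gen_z, True)]"
  have xyz_c: "x \<in> carrier H" "y \<in> carrier H" "z \<in> carrier H" by (simp_all add: x_def y_def z_def Wc)
  have W_xyz: "x [^]\<^bsub>H\<^esub> r = \<one>\<^bsub>H\<^esub>" "y [^]\<^bsub>H\<^esub> s = \<one>\<^bsub>H\<^esub>" "z [^]\<^bsub>H\<^esub> t = \<one>\<^bsub>H\<^esub>"
    unfolding x_def y_def z_def W_replicate[symmetric]
    by (rule W_relator, simp add: R_def triangle_relators_def)+
  have pow_N: "w [^]\<^bsub>H\<^esub> N = \<one>\<^bsub>H\<^esub>"
    if "w \<in> carrier H" "w [^]\<^bsub>H\<^esub> k = \<one>\<^bsub>H\<^esub>" "k dvd N" for w k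
  proof -
    obtain m where m: "N = k * m" using \<open>k dvd N\<close> by blast
    have "w [^]\<^bsub>H\<^esub> (k * m) = (w [^]\<^bsub>H\<^esub> k) [^]\<^bsub>H\<^esub> m"
      using that(1) by (simp only: H.nat_pow_pow)
    then show ?thesis using that(2) by (simp add: m)
  qed
  have pows: "x [^]\<^bsub>H\<^esub> N = \<one>\<^bsub>H\<^esub>" "y [^]\<^bsub>H\<^esub> N = \<one>\<^bsub>H\<^esub>" "z [^]\<^bsub>H\<^esub> N = \<one>\<^bsub>H\<^esub>"
    using pow_N[OF xyz_c(1) W_xyz(1)] pow_N[OF xyz_c(2) W_xyz(2)] pow_N[OF xyz_c(3) W_xyz(3)]
    by (simp_all add: N_def)
  have "x \<otimes>\<^bsub>H\<^esub> y \<otimes>\<^bsub>H\<^esub> z = W ([(Gen_x, True)] @ [(Gen_y, True)] @ [(Gen_z, True)])"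
    unfolding W_app x_def y_def z_def using Wc by (simp add: H.m_assoc)
  also have "\<dots> = \<one>\<^bsub>H\<^esub>"
    by (rule W_relator) (simp add: R_def triangle_relators_def)
  finally have xyz: "x \<otimes>\<^bsub>H\<^esub> y \<otimes>\<^bsub>H\<^esub> z = \<one>\<^bsub>H\<^esub>" .
  \<comment> \<open>This makes \<open>x\<close> and \<open>y\<close> alone generate \<open>H\<close>
    and carries the exponent of \<open>z\<close> over to their product.\<close>
  then have xy: "x \<otimes>\<^bsub>H\<^esub> y = inv\<^bsub>H\<^esub> z"
    using xyz_c by (simp add: H.inv_equality)
  have pow_xy: "(x \<otimes>\<^bsub>H\<^esub> y) [^]\<^bsub>H\<^esub> N = \<one>\<^bsub>H\<^esub>"
    unfolding xy using xyz_c pows by (simp add: H.nat_pow_inv)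
  have gen: "S = carrier H" if S: "subgroup S H" "x \<in> S" "y \<in> S" for S
  proof -
    have "inv\<^bsub>H\<^esub> (x \<otimes>\<^bsub>H\<^esub> y) \<in> S"
      using subgroup.m_inv_closed[OF S(1) subgroup.m_closed[OF S]] .
    then have "z \<in> S" unfolding xy using xyz_c by simp
    have pos: "W [(a, True)] \<in> S" for a
      using S \<open>z \<in> S\<close> by (cases a) (simp_all add: x_def y_def z_def)
    have neg: "W [(a, False)] \<in> S" for a
    proof -
      have "W ([(a, False)] @ [(a, True)]) = \<one>\<^bsub>H\<^esub>"
        using W_eq[OF word_eq.cancel[of R "[]" a False "[]"]] by (simp add: W_Nil)
      then have "inv\<^bsub>H\<^esub> (W [(a, True)]) = W [(a, False)]"
        unfolding W_app using Wc by (simp add: H.inv_equality)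
      then show ?thesis using subgroup.m_inv_closed[OF S(1) pos[of a]] by simp
    qed
    have "W w \<in> S" for w
    proof (induction w)
      case Nil
      show ?case using subgroup.one_closed[OF S(1)] by (simp add: W_Nil)
    next
      case (Cons l w)
      have "W [l] \<in> S" using pos neg by (cases l; cases "snd l") auto
      then show ?case using subgroup.m_closed[OF S(1) _ Cons] W_app[of "[l]" w] by simp
    qed
    then have "carrier H \<subseteq> S"
      unfolding img[symmetric] by (auto simp: presented_group_def W_def)
    then show ?thesis using subgroup.subset[OF S(1)] by simp
  qed
  have "N > 0" using assms by (simp add: N_def)
  have prime: "prime p" "p > N + 4" "gcd N (p - 1) dvd 2"
    using p(1) by (simp_all add: good_prime_def N_def)
  show False
  proof (rule H.no_triangle_generators[OF H(2) prime(1) _ \<open>N > 0\<close> prime(3) _ _ _ _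
        xyz_c(1) pows(1) xyz_c(2) pows(2) pow_xy gen])
    show "p > 2" using prime(2) by simp
    show "\<not> p dvd N" using prime(2) \<open>N > 0\<close> by (auto dest: dvd_imp_le)
    show "p dvd order H" using p(2) H(3) by simp
    show "\<not> p ^ 2 dvd order H" using not_exc H(3) by (simp add: exceptional_def)
    show "\<not> p * (1 + j * p) dvd order H" if "j > 0" for j
      using not_exc that unfolding exceptional_def H(3) by blast
  qed
qed

section \<open>Density\<close>

lemma ex_nat_root:
  assumes "D > 0"
  shows "\<exists>u. u ^ D \<le> x \<and> x < Suc u ^ D"
proof -
  have "Suc x \<le> Suc x ^ D" using assms by (intro self_le_power) auto
  then have "x < Suc x ^ D" by simp
  moreover have "\<not> x < 0 ^ D" using assms by (cases D) auto
  ultimately obtain k where "\<forall>i\<le>k. \<not> x < i ^ D" "x < Suc k ^ D"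
    using ex_least_nat_less[of "\<lambda>k. x < k ^ D" "Suc x"] by blast
  then show ?thesis by (intro exI[of _ k]) auto
qed

text \<open>Up to \<open>x\<close>, elements of \<open>Q\<close> either have no prime divisor in a
  set \<open>T\<close> with large reciprocal sum, or are exceptional for some \<open>p > u\<close>.
  The second moment bound handles the former and the union bound the latter.\<close>

lemma natural_density_zero:
  assumes "N > 0" and Q: "\<And>n p. n \<in> Q \<Longrightarrow> good_prime N p \<Longrightarrow> p dvd n \<Longrightarrow> exceptional p n"
  shows "has_natural_density Q 0"
  unfolding has_natural_density_def
proof (rule LIMSEQ_I)
  fix \<epsilon> :: real assume "\<epsilon> > 0"
  \<comment> \<open>With this value the second moment bound \<open>3 * x / K\<close> becomes
    \<open>\<epsilon> * x / 4\<close>.\<close>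
  define K where "K = 12 / \<epsilon>"
  have "K > 0" using \<open>\<epsilon> > 0\<close> by (simp add: K_def)
  obtain c C where c: "c > 0"
    "\<And>x. x > 0 \<Longrightarrow> c * ln (real x) - C \<le> (\<Sum>p\<in>{p\<in>{1..x}. good_prime N p}. ln (real p) / real p)"
    by (rule sum_good_primes_ge[OF \<open>N > 0\<close>]) (rule that)
  have "\<exists>D U. D > 0 \<and> (\<forall>u\<ge>U. K \<le> (\<Sum>p\<in>{p\<in>{u<..u^D}. good_prime N p}. 1 / real p))"
  proof (rule reciprocal_sum_large[of "{p. good_prime N p}" c C K])
    show "prime p" if "p \<in> {p. good_prime N p}" for p using that by (simp add: good_prime_def)
    show "c * ln (real x) - C \<le> (\<Sum>p\<in>{p\<in>{1..x}. p \<in> {p. good_prime N p}}. ln (real p) / real p)"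
      if "x > 0" for x using c(2)[OF that] by simp
    fix D U :: nat assume "D > 0"
      and "\<And>u. u \<ge> U \<Longrightarrow> K \<le> (\<Sum>p\<in>{p\<in>{u<..u^D}. p \<in> {p. good_prime N p}}. 1 / real p)"
    then show ?thesis by (intro exI[of _ D] exI[of _ U]) simp
  qed (rule c(1))
  then obtain D U where D: "D > 0"
    and U: "\<And>u. u \<ge> U \<Longrightarrow> K \<le> (\<Sum>p\<in>{p\<in>{u<..u^D}. good_prime N p}. 1 / real p)"
    by blast
  have "((\<lambda>u::nat. (2 + real D * ln (real u + 1)) / real u) \<longlongrightarrow> 0) sequentially"
    by real_asymp
  then have "\<forall>\<^sub>F u in sequentially. (2 + real D * ln (real u + 1)) / real u < \<epsilon> / 2"
    using \<open>\<epsilon> > 0\<close> by (intro order_tendstoD) auto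
  then obtain V where V: "\<And>u. u \<ge> V \<Longrightarrow> (2 + real D * ln (real u + 1)) / real u < \<epsilon> / 2"
    unfolding eventually_sequentially by blast
  show "\<exists>x0. \<forall>x\<ge>x0. norm (partial_density Q x - 0) < \<epsilon>"
  proof (intro exI allI impI)
    fix x assume x: "x \<ge> (U + V + 1) ^ D"
    have "(U + V + 1) ^ D > 0" by simp
    then have "x > 0" using x by linarith
    \<comment> \<open>The integer root of \<open>x\<close> of degree \<open>D\<close>: the primes in
      \<open>T\<close> then do not exceed \<open>x\<close>, which bounds \<open>card T\<close>,
      while \<open>ln x \<le> D * ln (u + 1)\<close> is negligible against \<open>u\<close>.\<close>
    obtain u where u: "u ^ D \<le> x" "x < Suc u ^ D" using ex_nat_root[OF D] by blast
    have "(U + V + 1) ^ D < Suc u ^ D" using x u by linarith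
    then have "U + V + 1 < Suc u" by (rule power_less_imp_less_base) simp
    then have uUV: "u \<ge> U" "u \<ge> V" "u > 0" by auto
    define T where "T = {p\<in>{u<..u^D}. good_prime N p}"
    define E where "E = (\<Sum>p\<in>T. 1 / real p)"
    have E: "K \<le> E" unfolding E_def T_def by (rule U[OF uUV(1)])
    have "card T \<le> card {1..u^D}" unfolding T_def by (intro card_mono) auto
    then have "card T \<le> x" using u by simp
    let ?A = "{n\<in>{1..x}. \<forall>p\<in>T. \<not> p dvd n}" and ?B = "{n\<in>{1..x}. \<exists>p>u. exceptional p n}"
    have "Q \<inter> {1..x} \<subseteq> ?A \<union> ?B" using Q by (auto simp: T_def)
    then have "card (Q \<inter> {1..x}) \<le> card (?A \<union> ?B)" by (intro card_mono) auto
    also have "\<dots> \<le> card ?A + card ?B" by (rule card_Un_le)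
    finally have "real (card (Q \<inter> {1..x})) \<le> real (card ?A) + real (card ?B)" by linarith
    also have "\<dots> \<le> 3 * real x / K + real x * (2 + ln (real (max 1 x))) / real u"
    proof (rule add_mono)
      have "real (card ?A) \<le> (real x + 2 * real (card T)) / E"
      proof (rule card_no_prime_divisor_le)
        show "finite T" by (simp add: T_def)
        show "prime p" if "p \<in> T" for p using that by (simp add: T_def good_prime_def)
      qed (use E \<open>K > 0\<close> in \<open>simp_all add: E_def\<close>)
      also have "\<dots> \<le> 3 * real x / K"
        using E \<open>K > 0\<close> \<open>card T \<le> x\<close> by (intro frac_le) auto
      finally show "real (card ?A) \<le> 3 * real x / K" .
      show "real (card ?B) \<le> real x * (2 + ln (real (max 1 x))) / real u"
        by (rule card_exceptional_le[OF uUV(3)])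
    qed
    also have "\<dots> = real x * (\<epsilon> / 4 + (2 + ln (real x)) / real u)"
      using \<open>x > 0\<close> \<open>\<epsilon> > 0\<close> by (simp add: K_def field_simps max_def)
    also have "\<dots> < real x * \<epsilon>"
    proof -
      have "real x \<le> real (Suc u ^ D)" using u(2) unfolding of_nat_le_iff by (rule less_imp_le)
      then have "ln (real x) \<le> ln (real (Suc u ^ D))" using \<open>x > 0\<close> by (intro ln_mono) auto
      also have "\<dots> = real D * ln (real u + 1)" by (simp add: ln_realpow add.commute)
      finally have "(2 + ln (real x)) / real u \<le> (2 + real D * ln (real u + 1)) / real u"
        by (intro divide_right_mono) auto
      also have "\<dots> < \<epsilon> / 2" by (rule V[OF uUV(2)])
      finally have "\<epsilon> / 4 + (2 + ln (real x)) / real u < \<epsilon>" using \<open>\<epsilon> > 0\<close> by linarith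
      then show ?thesis using \<open>x > 0\<close> by (intro mult_strict_left_mono) auto
    qed
    finally show "norm (partial_density Q x - 0) < \<epsilon>"
      using \<open>x > 0\<close> by (simp add: partial_density_def field_simps)
  qed
qed

theorem theorem1:
  fixes r s t :: nat
  assumes "r > 0" and "s > 0" and "t > 0"
  shows "has_natural_density (finite_quotient_orders (triangle_group r s t)) 0"
proof (rule natural_density_zero[of "r * s * t"])
  show "r * s * t > 0" using assms by simp
qed (rule good_prime_dvd_quotient_order[OF assms])

end
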